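(* Consider the equation $w_xE_x+w_yE_y+E(w_{xx}+w_{yy})=-1$ with $w=w(x,y)$ and $E=E(x,y)$ both dependent variables, and a nonclassical generator $\mathcal U=\xi\,\partial_x+\partial_y+\phi\,\partial_w+\psi\,\partial_E$ of this equation with $\xi=A(x,y)$ and $\phi=G(x,y,w)$. Let $k\neq 0$ be a constant and let $Q=Q(u,w)$, with $Q_w\neq 0$, satisfy $$Q_u\,(Q_u-u)_w-Q_w\,(Q_u-u)_u=0 .$$ If $A(x,y)=k$ and $G(x,y,w)=-(k^2+1)Q_u/Q_w$ evaluated at $u=u(x,y)=kx+y$, then the nonclassical generator is $$\mathcal U=k\,\partial_x+\partial_y-(k^2+1)\frac{Q_u}{Q_w}\,\partial_w+(k^2+1)E\left(\frac{Q_u}{Q_w}\right)_{\!w}\partial_E ,$$ where $Q_u/Q_w$ and its $w$-derivative are evaluated at $u=kx+y$.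
   Context: All functions are assumed real analytic on open domains, and $E\neq 0$. Put $F=w_xE_x+w_yE_y+E(w_{xx}+w_{yy})+1$ on the second-order jet space with independent variables $x,y$ and dependent variables $w,E$. For a vector field $\mathcal U=\xi\,\partial_x+\partial_y+\phi\,\partial_w+\psi\,\partial_E$ with $\xi,\phi,\psi$ functions of $(x,y,w,E)$ (the coefficient of $\partial_y$ is normalized to $1$), put $\phi_1=\xi w_x+w_y-\phi$ and $\phi_2=\xi E_x+E_y-\psi$. $\mathcal U$ is called a nonclassical generator (generator of a nonclassical equivalence transformation, or conditional symmetry) of the equation $F=0$ if $\mathrm{pr}^{(2)}\mathcal U(F)=0$, $\mathrm{pr}^{(1)}\mathcal U(\phi_1)=0$ and $\mathrm{pr}^{(1)}\mathcal U(\phi_2)=0$ at all jet points where $F=0$, $\phi_1=\phi_2=0$, and the total derivatives of $\phi_1,\phi_2$ with respect to $x$ and $y$ vanish. Here $\mathrm{pr}^{(n)}\mathcal U$ is the usual $n$-th prolongation ($x,y$ independent, $w,E$ dependent). A statement that "the nonclassical generator" with prescribed $\xi$ and $\phi$ is a given vector field means that this vector field is a nonclassical generator and is the one with those $\xi,\phi$. In the equation for $Q$, the variables $u$ and $w$ are independent, and subscripts denote partial derivatives. *)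

theory Defs
  imports "HOL-Analysis.Analysis"
begin

text \<open>
  Real analyticity in several variables: near every point of \<open>S\<close> the function is the sum of a
  power series. The multi-indices are the functions from the standard basis to the naturals
  (extensional, so that each of them is counted once).
\<close>

definition real_analytic_on :: "('a::euclidean_space \<Rightarrow> real) \<Rightarrow> 'a set \<Rightarrow> bool" where
  "real_analytic_on f S \<longleftrightarrow>
     (\<forall>p\<in>S. \<exists>r>0. \<exists>a :: ('a \<Rightarrow> nat) \<Rightarrow> real. \<forall>q\<in>ball p r.
        ((\<lambda>\<alpha>. a \<alpha> * (\<Prod>b\<in>Basis. ((q - p) \<bullet> b) ^ \<alpha> b)) has_sum f q)
          (Basis \<rightarrow>\<^sub>E UNIV))"

text \<open>Partial derivatives of a function of the independent variables \<open>(u, w)\<close>.\<close>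

definition D_u :: "(real \<times> real \<Rightarrow> real) \<Rightarrow> real \<times> real \<Rightarrow> real" where
  "D_u f = (\<lambda>(u, w). deriv (\<lambda>t. f (t, w)) u)"

definition D_w :: "(real \<times> real \<Rightarrow> real) \<Rightarrow> real \<times> real \<Rightarrow> real" where
  "D_w f = (\<lambda>(u, w). deriv (\<lambda>t. f (u, t)) w)"

text \<open>
  The fourteen coordinates of the second-order jet space with independent variables \<open>x, y\<close> and
  dependent variables \<open>w, E\<close>. A jet point assigns a real number to each coordinate.
\<close>

datatype coord =
    Jx | Jy | Jw | JE
  | Jwx | Jwy | JEx | JEy
  | Jwxx | Jwxy | Jwyy | JExx | JExy | JEyy

lemma UNIV_coord:
  "(UNIV :: coord set) =
     {Jx, Jy, Jw, JE, Jwx, Jwy, JEx, JEy, Jwxx, Jwxy, Jwyy, JExx, JExy, JEyy}"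
proof -
  have "c \<in> {Jx, Jy, Jw, JE, Jwx, Jwy, JEx, JEy, Jwxx, Jwxy, Jwyy, JExx, JExy, JEyy}" for c
    by (cases c) simp_all
  then show ?thesis by blast
qed

instance coord :: finite
  by standard (simp add: UNIV_coord)

fun jet_order :: "coord \<Rightarrow> nat" where
  "jet_order Jx = 0" | "jet_order Jy = 0" | "jet_order Jw = 0" | "jet_order JE = 0"
| "jet_order Jwx = 1" | "jet_order Jwy = 1" | "jet_order JEx = 1" | "jet_order JEy = 1"
| "jet_order Jwxx = 2" | "jet_order Jwxy = 2" | "jet_order Jwyy = 2"
| "jet_order JExx = 2" | "jet_order JExy = 2" | "jet_order JEyy = 2"

type_synonym jet = "coord \<Rightarrow> real"
type_synonym point = "real \<times> real \<times> real \<times> real"  \<comment> \<open>\<open>(x, y, w, E)\<close>\<close>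

definition base :: "jet \<Rightarrow> point" where
  "base j = (j Jx, j Jy, j Jw, j JE)"

definition partial :: "coord \<Rightarrow> (jet \<Rightarrow> real) \<Rightarrow> jet \<Rightarrow> real" where
  "partial c f j = deriv (\<lambda>t. f (j(c := t))) (j c)"

text \<open>
  Total derivatives. They are only to be applied to functions of jet order at most one, so that
  the result is again a function on the second-order jet space.
\<close>

definition total_x :: "(jet \<Rightarrow> real) \<Rightarrow> jet \<Rightarrow> real" where
  "total_x f j = partial Jx f j + j Jwx * partial Jw f j + j JEx * partial JE f j
     + j Jwxx * partial Jwx f j + j Jwxy * partial Jwy f j
     + j JExx * partial JEx f j + j JExy * partial JEy f j"

definition total_y :: "(jet \<Rightarrow> real) \<Rightarrow> jet \<Rightarrow> real" where
  "total_y f j = partial Jy f j + j Jwy * partial Jw f j + j JEy * partial JE f j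
     + j Jwxy * partial Jwx f j + j Jwyy * partial Jwy f j
     + j JExy * partial JEx f j + j JEyy * partial JEy f j"

text \<open>The vector field \<open>\<xi> \<partial>\<^sub>x + \<eta> \<partial>\<^sub>y + \<phi> \<partial>\<^sub>w + \<psi> \<partial>\<^sub>E\<close>.\<close>

record vfield =
  xi :: "point \<Rightarrow> real"
  eta :: "point \<Rightarrow> real"
  phi :: "point \<Rightarrow> real"
  psi :: "point \<Rightarrow> real"

text \<open>
  One step of the recursive prolongation formula: if \<open>f\<close> is the coefficient of \<open>\<partial>/\<partial>v\<close>, where \<open>v\<close>
  is a dependent variable or one of its derivatives, and \<open>vx, vy\<close> are the coordinates for the
  \<open>x\<close>- and \<open>y\<close>-derivative of \<open>v\<close>, then \<open>prol_x U vx vy f\<close> is the coefficient of \<open>\<partial>/\<partial>vx\<close> and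
  \<open>prol_y U vx vy f\<close> is the coefficient of \<open>\<partial>/\<partial>vy\<close>.
\<close>

definition prol_x :: "vfield \<Rightarrow> coord \<Rightarrow> coord \<Rightarrow> (jet \<Rightarrow> real) \<Rightarrow> jet \<Rightarrow> real" where
  "prol_x U vx vy f j =
     total_x f j - j vx * total_x (xi U \<circ> base) j - j vy * total_x (eta U \<circ> base) j"

definition prol_y :: "vfield \<Rightarrow> coord \<Rightarrow> coord \<Rightarrow> (jet \<Rightarrow> real) \<Rightarrow> jet \<Rightarrow> real" where
  "prol_y U vx vy f j =
     total_y f j - j vx * total_y (xi U \<circ> base) j - j vy * total_y (eta U \<circ> base) j"

fun prol_coeff :: "vfield \<Rightarrow> coord \<Rightarrow> jet \<Rightarrow> real" where
  "prol_coeff U Jx = xi U \<circ> base"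
| "prol_coeff U Jy = eta U \<circ> base"
| "prol_coeff U Jw = phi U \<circ> base"
| "prol_coeff U JE = psi U \<circ> base"
| "prol_coeff U Jwx = prol_x U Jwx Jwy (phi U \<circ> base)"
| "prol_coeff U Jwy = prol_y U Jwx Jwy (phi U \<circ> base)"
| "prol_coeff U JEx = prol_x U JEx JEy (psi U \<circ> base)"
| "prol_coeff U JEy = prol_y U JEx JEy (psi U \<circ> base)"
| "prol_coeff U Jwxx = prol_x U Jwxx Jwxy (prol_x U Jwx Jwy (phi U \<circ> base))"
| "prol_coeff U Jwxy = prol_y U Jwxx Jwxy (prol_x U Jwx Jwy (phi U \<circ> base))"
| "prol_coeff U Jwyy = prol_y U Jwxy Jwyy (prol_y U Jwx Jwy (phi U \<circ> base))"
| "prol_coeff U JExx = prol_x U JExx JExy (prol_x U JEx JEy (psi U \<circ> base))"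
| "prol_coeff U JExy = prol_y U JExx JExy (prol_x U JEx JEy (psi U \<circ> base))"
| "prol_coeff U JEyy = prol_y U JExy JEyy (prol_y U JEx JEy (psi U \<circ> base))"

text \<open>The \<open>n\<close>-th prolongation of \<open>U\<close> (for \<open>n \<le> 2\<close>), applied to a function on the jet space.\<close>

definition pr :: "nat \<Rightarrow> vfield \<Rightarrow> (jet \<Rightarrow> real) \<Rightarrow> jet \<Rightarrow> real" where
  "pr n U f j = (\<Sum>c | jet_order c \<le> n. prol_coeff U c j * partial c f j)"

definition F_eq :: "jet \<Rightarrow> real" where
  "F_eq j = j Jwx * j JEx + j Jwy * j JEy + j JE * (j Jwxx + j Jwyy) + 1"

definition inv_surf1 :: "vfield \<Rightarrow> jet \<Rightarrow> real" where
  "inv_surf1 U j = xi U (base j) * j Jwx + j Jwy - phi U (base j)"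

definition inv_surf2 :: "vfield \<Rightarrow> jet \<Rightarrow> real" where
  "inv_surf2 U j = xi U (base j) * j JEx + j JEy - psi U (base j)"

text \<open>
  \<open>U\<close> is a nonclassical generator of the equation \<open>F_eq = 0\<close>, the coefficients of \<open>U\<close> being
  real analytic functions on the open set \<open>D\<close>, on which \<open>E \<noteq> 0\<close>. Values of the coefficients
  outside \<open>D\<close> play no role.
\<close>

definition nonclassical_generator :: "point set \<Rightarrow> vfield \<Rightarrow> bool" where
  "nonclassical_generator D U \<longleftrightarrow>
     open D \<and> (\<forall>(x, y, w, E)\<in>D. E \<noteq> 0) \<and>
     real_analytic_on (xi U) D \<and> real_analytic_on (phi U) D \<and> real_analytic_on (psi U) D \<and>
     (\<forall>p\<in>D. eta U p = 1) \<and>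
     (\<forall>j. base j \<in> D \<and> F_eq j = 0 \<and> inv_surf1 U j = 0 \<and> inv_surf2 U j = 0 \<and>
          total_x (inv_surf1 U) j = 0 \<and> total_y (inv_surf1 U) j = 0 \<and>
          total_x (inv_surf2 U) j = 0 \<and> total_y (inv_surf2 U) j = 0 \<longrightarrow>
          pr 2 U F_eq j = 0 \<and> pr 1 U (inv_surf1 U) j = 0 \<and> pr 1 U (inv_surf2 U) j = 0)"

end

theory Submission
  imports Defs
begin

text \<open>
  Write \<open>h = Q\<^sub>u / Q\<^sub>w\<close> and \<open>c = k\<^sup>2 + 1\<close>. The equation for \<open>Q\<close> says \<open>h\<^sub>u = 1 / Q\<^sub>w\<close>, and equality of
  the mixed derivatives of \<open>Q\<close> turns this into \<open>h\<^sub>u\<^sub>u = h h\<^sub>u\<^sub>w - h\<^sub>w h\<^sub>u\<close>. With \<open>\<xi> = k\<close>, \<open>\<phi> = - c h\<close>,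
  \<open>\<psi> = c E h\<^sub>w\<close>, the prolongation applied to the equation collapses on the invariant surfaces to
  \<open>c\<^sup>2 E (h h\<^sub>u\<^sub>w - h\<^sub>w h\<^sub>u - h\<^sub>u\<^sub>u) = 0\<close>.

  Conversely, let \<open>\<psi>\<close> be the last coefficient of any generator with these \<open>\<xi>\<close> and \<open>\<phi>\<close>. On the
  constraint set \<open>w\<^sub>x\<close> and \<open>E\<^sub>x\<close> are free, and the condition is a polynomial in them. Its coefficient
  of \<open>w\<^sub>x E\<^sub>x\<close> gives \<open>\<psi>\<^sub>E = \<psi> / E\<close>, so locally \<open>\<psi> = E m(x, y, w)\<close>. Then its constant term has the form
  \<open>E S - m - \<phi>\<^sub>w\<close> with \<open>S\<close> and \<open>m\<close> independent of \<open>E\<close>, whence \<open>m = - \<phi>\<^sub>w\<close>.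

  Analyticity of the coefficients is obtained by working with power series that converge absolutely
  on a cube. With the weighted \<open>\<ell>\<^sup>1\<close> norm of their coefficients they form a Banach algebra, in which
  products, inverses and compositions are absolutely convergent sums of monomials.
\<close>

section \<open>Absolutely convergent power series\<close>

abbreviation multi_indices :: "('a::euclidean_space \<Rightarrow> nat) set" where
  "multi_indices \<equiv> Basis \<rightarrow>\<^sub>E UNIV"

definition mono_fun :: "('a::euclidean_space \<Rightarrow> nat) \<Rightarrow> 'a \<Rightarrow> real" where
  "mono_fun \<alpha> x = (\<Prod>b\<in>Basis. (x \<bullet> b) ^ \<alpha> b)"

definition mdeg :: "('a::euclidean_space \<Rightarrow> nat) \<Rightarrow> nat" where
  "mdeg \<alpha> = (\<Sum>b\<in>Basis. \<alpha> b)"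

text \<open>The closed ball of the supremum norm. At its corner with all coordinates
  \<open>r\<close> every monomial attains its largest value \<open>r ^ mdeg \<alpha>\<close>, which
  ties the weighted norm to convergence at a single point.\<close>

definition cube :: "real \<Rightarrow> 'a::euclidean_space set" where
  "cube r = {x. \<forall>b\<in>Basis. \<bar>x \<bullet> b\<bar> \<le> r}"

definition expansion ::
  "(('a::euclidean_space \<Rightarrow> nat) \<Rightarrow> real) \<Rightarrow> real \<Rightarrow> ('a \<Rightarrow> real) \<Rightarrow> bool" where
  "expansion a r f \<longleftrightarrow> (\<lambda>\<alpha>. \<bar>a \<alpha>\<bar> * r ^ mdeg \<alpha>) summable_on multi_indices \<and>
     (\<forall>x\<in>cube r. ((\<lambda>\<alpha>. a \<alpha> * mono_fun \<alpha> x) has_sum f x) multi_indices)"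

text \<open>A weighted Wiener algebra. The norm occurs only through an upper bound \<open>N\<close>
  for some choice of coefficients, which avoids having to know that \<open>f\<close> determines
  them.\<close>

definition wiener :: "real \<Rightarrow> real \<Rightarrow> ('a::euclidean_space \<Rightarrow> real) \<Rightarrow> bool" where
  "wiener r N f \<longleftrightarrow>
     (\<exists>a. expansion a r f \<and> (\<Sum>\<^sub>\<infinity>\<alpha>\<in>multi_indices. \<bar>a \<alpha>\<bar> * r ^ mdeg \<alpha>) \<le> N)"

lemma abs_mono_fun_le:
  assumes "x \<in> cube r"
  shows "\<bar>mono_fun \<alpha> x\<bar> \<le> r ^ mdeg \<alpha>"
proof -
  have "\<bar>mono_fun \<alpha> x\<bar> = (\<Prod>b\<in>Basis. \<bar>x \<bullet> b\<bar> ^ \<alpha> b)"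
    unfolding mono_fun_def abs_prod by (simp add: power_abs)
  also have "\<dots> \<le> (\<Prod>b\<in>Basis. r ^ \<alpha> b)"
    using assms by (intro prod_mono) (auto simp: cube_def intro!: power_mono)
  also have "\<dots> = r ^ mdeg \<alpha>" by (simp add: mdeg_def power_sum)
  finally show ?thesis .
qed

text \<open>Completeness of the algebra: the coefficients of the limit are the sums of the
  coefficients of the \<open>f i\<close>, and absolute convergence of the double series allows the
  order of summation to be exchanged. Sums, products, compositions and geometric series are obtained
  from this lemma.\<close>

lemma wiener_has_sum:
  fixes f :: "'i \<Rightarrow> 'a::euclidean_space \<Rightarrow> real"
  assumes r: "0 < r" and f: "\<And>i. i \<in> I \<Longrightarrow> wiener r (N i) (f i)"
    and N: "N summable_on I" "infsum N I \<le> M"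
    and g: "\<And>x. x \<in> cube r \<Longrightarrow> ((\<lambda>i. f i x) has_sum g x) I"
  shows "wiener r M g"
proof -
  let ?MI = "multi_indices :: ('a \<Rightarrow> nat) set"
  have "\<forall>i. \<exists>a. i \<in> I \<longrightarrow> expansion a r (f i) \<and> (\<Sum>\<^sub>\<infinity>\<alpha>\<in>?MI. \<bar>a \<alpha>\<bar> * r ^ mdeg \<alpha>) \<le> N i"
    using f by (auto simp: wiener_def)
  then obtain a where a: "\<And>i. i \<in> I \<Longrightarrow> expansion (a i) r (f i)"
    and aN: "\<And>i. i \<in> I \<Longrightarrow> (\<Sum>\<^sub>\<infinity>\<alpha>\<in>?MI. \<bar>a i \<alpha>\<bar> * r ^ mdeg \<alpha>) \<le> N i"
    by (metis (no_types))
  define T where "T i \<alpha> = \<bar>a i \<alpha>\<bar> * r ^ mdeg \<alpha>" for i \<alpha>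
  have T0: "0 \<le> T i \<alpha>" for i \<alpha> using r by (simp add: T_def)
  have Ti: "T i summable_on ?MI" if "i \<in> I" for i
    using a[OF that] by (simp add: expansion_def T_def[abs_def])
  have "(\<lambda>i. infsum (T i) ?MI) summable_on I"
    by (rule summable_on_comparison_test[OF N(1)])
      (use aN T0 in \<open>auto simp: T_def[abs_def] intro!: infsum_nonneg\<close>)
  then have T: "(\<lambda>(i, \<alpha>). T i \<alpha>) summable_on I \<times> ?MI"
    using Ti T0 by (intro summable_on_SigmaI[where g = "\<lambda>i. infsum (T i) ?MI"]) auto
  have swap: "(\<lambda>(\<alpha>, i). F i \<alpha>) summable_on ?MI \<times> I"
    if "(\<lambda>(i, \<alpha>). F i \<alpha>) summable_on I \<times> ?MI" for F :: "'i \<Rightarrow> ('a \<Rightarrow> nat) \<Rightarrow> real"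
    using summable_on_swap[of "\<lambda>(i, \<alpha>). F i \<alpha>" I ?MI] that
    by (simp add: case_prod_unfold o_def)
  have Ta: "(\<lambda>i. T i \<alpha>) summable_on I" if "\<alpha> \<in> ?MI" for \<alpha>
    using summable_on_SigmaD1[OF swap[OF T] that] .
  have Tsum: "(\<lambda>\<alpha>. \<Sum>\<^sub>\<infinity>i\<in>I. T i \<alpha>) summable_on ?MI"
    using summable_on_Sigma_banach[OF swap[OF T]] .
  have aa: "(\<lambda>i. \<bar>a i \<alpha>\<bar>) summable_on I" if "\<alpha> \<in> ?MI" for \<alpha>
    using Ta[OF that] r by (simp add: T_def summable_on_cmult_left')
  define A where "A \<alpha> = (\<Sum>\<^sub>\<infinity>i\<in>I. a i \<alpha>)" for \<alpha>
  have A: "\<bar>A \<alpha>\<bar> * r ^ mdeg \<alpha> \<le> (\<Sum>\<^sub>\<infinity>i\<in>I. T i \<alpha>)" if "\<alpha> \<in> ?MI" for \<alpha>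
  proof -
    have "\<bar>A \<alpha>\<bar> \<le> (\<Sum>\<^sub>\<infinity>i\<in>I. \<bar>a i \<alpha>\<bar>)"
      unfolding A_def using norm_infsum_bound[of "\<lambda>i. a i \<alpha>" I] aa[OF that] by simp
    then have "\<bar>A \<alpha>\<bar> * r ^ mdeg \<alpha> \<le> (\<Sum>\<^sub>\<infinity>i\<in>I. \<bar>a i \<alpha>\<bar>) * r ^ mdeg \<alpha>"
      using r by (intro mult_right_mono) auto
    also have "\<dots> = (\<Sum>\<^sub>\<infinity>i\<in>I. T i \<alpha>)"
      by (simp add: T_def infsum_cmult_left')
    finally show ?thesis .
  qed
  have Asum: "(\<lambda>\<alpha>. \<bar>A \<alpha>\<bar> * r ^ mdeg \<alpha>) summable_on ?MI"
    by (rule summable_on_comparison_test[OF Tsum]) (use A r in auto)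
  have "(\<Sum>\<^sub>\<infinity>\<alpha>\<in>?MI. \<bar>A \<alpha>\<bar> * r ^ mdeg \<alpha>) \<le> (\<Sum>\<^sub>\<infinity>\<alpha>\<in>?MI. \<Sum>\<^sub>\<infinity>i\<in>I. T i \<alpha>)"
    by (rule infsum_mono[OF Asum Tsum A])
  also have "\<dots> = (\<Sum>\<^sub>\<infinity>i\<in>I. infsum (T i) ?MI)"
    using infsum_swap_banach[OF T] by simp
  also have "\<dots> \<le> infsum N I"
    by (rule infsum_mono) (use N aN in \<open>auto simp: T_def[abs_def] \<open>(\<lambda>i. infsum (T i) ?MI) summable_on I\<close>[unfolded T_def[abs_def]]\<close>)
  finally have norm: "(\<Sum>\<^sub>\<infinity>\<alpha>\<in>?MI. \<bar>A \<alpha>\<bar> * r ^ mdeg \<alpha>) \<le> M" using N by simp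
  have "((\<lambda>\<alpha>. A \<alpha> * mono_fun \<alpha> x) has_sum g x) ?MI" if x: "x \<in> cube r" for x
  proof -
    let ?F = "\<lambda>i \<alpha>. a i \<alpha> * mono_fun \<alpha> x"
    have F: "(\<lambda>p. case p of (i, \<alpha>) \<Rightarrow> ?F i \<alpha>) summable_on I \<times> ?MI"
      by (rule iffD2[OF summable_on_iff_abs_summable_on_real],
          rule summable_on_comparison_test[OF T])
        (auto simp: T_def abs_mult intro!: mult_left_mono abs_mono_fun_le x)
    have "((\<lambda>(i, \<alpha>). ?F i \<alpha>) has_sum g x) (I \<times> ?MI)"
      by (rule has_sum_SigmaI[OF _ g[OF x] F]) (use a x in \<open>auto simp: expansion_def\<close>)
    then have "((\<lambda>(\<alpha>, i). ?F i \<alpha>) has_sum g x) (?MI \<times> I)"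
      using has_sum_swap[of "\<lambda>(i, \<alpha>). ?F i \<alpha>" I ?MI] by (simp add: case_prod_unfold o_def)
    then show ?thesis
    proof (rule has_sum_SigmaD)
      fix \<alpha> assume "\<alpha> \<in> ?MI"
      then have "(\<lambda>i. a i \<alpha>) summable_on I"
        using aa iffD2[OF summable_on_iff_abs_summable_on_real, of "\<lambda>i. a i \<alpha>" I] by simp
      then show "((\<lambda>i. case (\<alpha>, i) of (\<alpha>, i) \<Rightarrow> ?F i \<alpha>) has_sum A \<alpha> * mono_fun \<alpha> x) I"
        by (auto simp: A_def intro!: has_sum_cmult_left)
    qed
  qed
  with Asum norm show ?thesis by (auto simp: wiener_def expansion_def)
qed

lemma wiener_cong:
  assumes "wiener r N f" "\<And>x. x \<in> cube r \<Longrightarrow> f x = g x"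
  shows "wiener r N g"
  using assms by (auto simp: wiener_def expansion_def)

lemma wiener_mono:
  assumes "wiener r N f" "N \<le> M"
  shows "wiener r M f"
  using assms by (meson wiener_def order_trans)

lemma has_sum_single:
  fixes F :: "'b \<Rightarrow> real"
  assumes "\<alpha> \<in> M"
  shows "((\<lambda>\<beta>. (if \<beta> = \<alpha> then c else 0) * F \<beta>) has_sum c * F \<alpha>) M"
proof -
  have "((\<lambda>\<beta>. (if \<beta> = \<alpha> then c else 0) * F \<beta>) has_sum c * F \<alpha>) {\<alpha>}"
    using has_sum_finite[of "{\<alpha>}" "\<lambda>\<beta>. (if \<beta> = \<alpha> then c else 0) * F \<beta>"] by simp
  then show ?thesis
    by (rule has_sum_cong_neutral[THEN iffD1, rotated -1]) (use assms in auto)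
qed

lemma wiener_mono_fun: "wiener r (\<bar>c\<bar> * r ^ mdeg \<alpha>) (\<lambda>x. c * mono_fun \<alpha> x)"
proof -
  \<comment> \<open>Multi-indices are extensional, so \<open>\<alpha>\<close> is cut down to
    \<open>Basis\<close> first; degree and monomial depend only on its values there.\<close>
  let ?\<alpha> = "restrict \<alpha> Basis"
  define a where "a \<beta> = (if \<beta> = ?\<alpha> then c else 0)" for \<beta>
  have \<alpha>: "?\<alpha> \<in> multi_indices" by auto
  have deg: "mdeg ?\<alpha> = mdeg \<alpha>" and fn: "mono_fun ?\<alpha> = mono_fun \<alpha>"
    by (simp_all add: mdeg_def mono_fun_def fun_eq_iff)
  have "((\<lambda>\<beta>. (if \<beta> = ?\<alpha> then \<bar>c\<bar> else 0) * r ^ mdeg \<beta>) has_sum \<bar>c\<bar> * r ^ mdeg \<alpha>) multi_indices"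
    using has_sum_single[OF \<alpha>, of "\<bar>c\<bar>" "\<lambda>\<beta>. r ^ mdeg \<beta>"] by (simp add: deg)
  then have 1: "((\<lambda>\<beta>. \<bar>a \<beta>\<bar> * r ^ mdeg \<beta>) has_sum \<bar>c\<bar> * r ^ mdeg \<alpha>) multi_indices"
    by (rule has_sum_cong[THEN iffD1, rotated]) (auto simp: a_def)
  have 2: "((\<lambda>\<beta>. a \<beta> * mono_fun \<beta> x) has_sum c * mono_fun \<alpha> x) multi_indices" for x
    using has_sum_single[OF \<alpha>, of c "\<lambda>\<beta>. mono_fun \<beta> x"] by (simp add: a_def fn)
  show ?thesis
    unfolding wiener_def expansion_def
    using 1 2 has_sum_imp_summable[OF 1] infsumI[OF 1] by (intro exI[of _ a]) simp
qed

lemma wiener_const: "wiener r \<bar>c\<bar> (\<lambda>_. c)"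
  using wiener_mono_fun[of r c "\<lambda>_. 0"] by (simp add: mono_fun_def mdeg_def)

lemma wiener_inner:
  assumes "b \<in> Basis"
  shows "wiener r r (\<lambda>x. x \<bullet> b)"
proof -
  let ?\<alpha> = "\<lambda>c. if c = b then 1 else 0 :: nat"
  have "mono_fun ?\<alpha> x = x \<bullet> b" for x
  proof -
    have "mono_fun ?\<alpha> x = (\<Prod>c\<in>Basis. if c = b then x \<bullet> c else 1)"
      unfolding mono_fun_def by (rule prod.cong) auto
    then show ?thesis using assms by simp
  qed
  moreover have "mdeg ?\<alpha> = 1" using assms by (simp add: mdeg_def)
  ultimately show ?thesis using wiener_mono_fun[of r 1 ?\<alpha>] by simp
qed

text \<open>On the cube each monomial is at most its weight, so the weighted norm dominates the
  supremum norm. In a composition this keeps the inner values inside the cube of the outer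
  function.\<close>

lemma wiener_abs_le:
  assumes "wiener r N f" "x \<in> cube r"
  shows "\<bar>f x\<bar> \<le> N"
proof -
  obtain a where a: "expansion a r f" and N: "(\<Sum>\<^sub>\<infinity>\<alpha>\<in>multi_indices. \<bar>a \<alpha>\<bar> * r ^ mdeg \<alpha>) \<le> N"
    using assms(1) by (auto simp: wiener_def)
  have "norm (f x) \<le> (\<Sum>\<^sub>\<infinity>\<alpha>\<in>multi_indices. \<bar>a \<alpha>\<bar> * r ^ mdeg \<alpha>)"
    by (rule norm_infsum_le[where f = "\<lambda>\<alpha>. a \<alpha> * mono_fun \<alpha> x"
          and g = "\<lambda>\<alpha>. \<bar>a \<alpha>\<bar> * r ^ mdeg \<alpha>"])
      (use a assms(2) in \<open>auto simp: expansion_def abs_mult intro!: mult_left_mono abs_mono_fun_le\<close>)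
  with N show ?thesis by simp
qed

lemma wiener_nonneg:
  assumes "0 \<le> r" "wiener r N f"
  shows "0 \<le> N"
  using wiener_abs_le[OF assms(2), of 0] assms(1) by (simp add: cube_def)

section \<open>Algebra operations and change of radius\<close>

lemma wiener_add:
  assumes "0 < r" "wiener r M f" "wiener r N g"
  shows "wiener r (M + N) (\<lambda>x. f x + g x)"
\<comment> \<open>A two-term sum is a sum indexed by \<open>bool\<close>, with \<open>True\<close>
  standing for \<open>f\<close>.\<close>
proof (rule wiener_has_sum[where I = UNIV and N = "\<lambda>i. if i then M else N"
        and f = "\<lambda>i. if i then f else g"])
  show "((\<lambda>i. (if i then f else g) x) has_sum f x + g x) UNIV" for x
    using has_sum_finite[of UNIV "\<lambda>i. (if i then f else g) x"] by (simp add: UNIV_bool add.commute)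
qed (use assms in \<open>auto simp: UNIV_bool\<close>)

lemma mono_fun_mult: "mono_fun \<alpha> x * mono_fun \<beta> x = mono_fun (\<lambda>b. \<alpha> b + \<beta> b) x"
  by (simp add: mono_fun_def power_add prod.distrib)

lemma mdeg_add: "mdeg (\<lambda>b. \<alpha> b + \<beta> b) = mdeg \<alpha> + mdeg \<beta>"
  by (simp add: mdeg_def sum.distrib)

text \<open>The norm is submultiplicative because monomials multiply to monomials and their weights
  multiply. First \<open>g\<close> is multiplied by one term of \<open>f\<close>, then the results
  are summed over the terms of \<open>f\<close>.\<close>

lemma wiener_mult:
  assumes r: "0 < r" and "wiener r M f" "wiener r N g"
  shows "wiener r (M * N) (\<lambda>x. f x * g x)"
proof -
  let ?MI = "multi_indices :: ('a \<Rightarrow> nat) set"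
  obtain a where a: "expansion a r f" and M: "(\<Sum>\<^sub>\<infinity>\<alpha>\<in>?MI. \<bar>a \<alpha>\<bar> * r ^ mdeg \<alpha>) \<le> M"
    using assms(2) by (auto simp: wiener_def)
  obtain b where b: "expansion b r g" and N: "(\<Sum>\<^sub>\<infinity>\<alpha>\<in>?MI. \<bar>b \<alpha>\<bar> * r ^ mdeg \<alpha>) \<le> N"
    using assms(3) by (auto simp: wiener_def)
  have N0: "0 \<le> N" using wiener_nonneg assms by (meson less_imp_le)
  have smd: "wiener r (\<bar>a \<alpha>\<bar> * r ^ mdeg \<alpha> * N) (\<lambda>x. a \<alpha> * mono_fun \<alpha> x * g x)" for \<alpha>
  proof (rule wiener_has_sum[where I = ?MI
        and N = "\<lambda>\<beta>. \<bar>a \<alpha>\<bar> * r ^ mdeg \<alpha> * (\<bar>b \<beta>\<bar> * r ^ mdeg \<beta>)"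
        and f = "\<lambda>\<beta> x. a \<alpha> * mono_fun \<alpha> x * (b \<beta> * mono_fun \<beta> x)"])
    show "wiener r (\<bar>a \<alpha>\<bar> * r ^ mdeg \<alpha> * (\<bar>b \<beta>\<bar> * r ^ mdeg \<beta>))
            (\<lambda>x. a \<alpha> * mono_fun \<alpha> x * (b \<beta> * mono_fun \<beta> x))" for \<beta>
      using wiener_mono_fun[of r "a \<alpha> * b \<beta>" "\<lambda>b. \<alpha> b + \<beta> b"]
      by (simp add: mono_fun_mult[symmetric] mdeg_add power_add abs_mult mult_ac)
    show "(\<lambda>\<beta>. \<bar>a \<alpha>\<bar> * r ^ mdeg \<alpha> * (\<bar>b \<beta>\<bar> * r ^ mdeg \<beta>)) summable_on ?MI"
      using b by (intro summable_on_cmult_right) (auto simp: expansion_def)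
    show "(\<Sum>\<^sub>\<infinity>\<beta>\<in>?MI. \<bar>a \<alpha>\<bar> * r ^ mdeg \<alpha> * (\<bar>b \<beta>\<bar> * r ^ mdeg \<beta>)) \<le> \<bar>a \<alpha>\<bar> * r ^ mdeg \<alpha> * N"
      unfolding infsum_cmult_right' using N r by (intro mult_left_mono) auto
    show "((\<lambda>\<beta>. a \<alpha> * mono_fun \<alpha> x * (b \<beta> * mono_fun \<beta> x)) has_sum
             a \<alpha> * mono_fun \<alpha> x * g x) ?MI" if "x \<in> cube r" for x
      using b that by (intro has_sum_cmult_right) (auto simp: expansion_def)
  qed (use r in auto)
  show ?thesis
  proof (rule wiener_has_sum[OF r smd])
    show "(\<lambda>\<alpha>. \<bar>a \<alpha>\<bar> * r ^ mdeg \<alpha> * N) summable_on ?MI"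
      using a by (intro summable_on_cmult_left) (auto simp: expansion_def)
    show "(\<Sum>\<^sub>\<infinity>\<alpha>\<in>?MI. \<bar>a \<alpha>\<bar> * r ^ mdeg \<alpha> * N) \<le> M * N"
      unfolding infsum_cmult_left' using M N0 by (intro mult_right_mono) auto
    show "((\<lambda>\<alpha>. a \<alpha> * mono_fun \<alpha> x * g x) has_sum f x * g x) ?MI" if "x \<in> cube r" for x
      using a that by (intro has_sum_cmult_left) (auto simp: expansion_def)
  qed
qed

lemma wiener_power:
  assumes "0 < r" "wiener r N f"
  shows "wiener r (N ^ n) (\<lambda>x. f x ^ n)"
proof (induction n)
  case 0
  show ?case using wiener_const[of r 1] by simp
next
  case (Suc n)
  show ?case using wiener_mult[OF assms Suc] by simp
qed

lemma wiener_prod: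
  assumes "finite I" "0 < r" "\<And>i. i \<in> I \<Longrightarrow> wiener r (N i) (f i)"
  shows "wiener r (\<Prod>i\<in>I. N i) (\<lambda>x. \<Prod>i\<in>I. f i x)"
  using assms(1,3)
proof (induction I rule: finite_induct)
  case empty
  show ?case using wiener_const[of r 1] by simp
next
  case (insert i I)
  then show ?case using wiener_mult[OF assms(2), of "N i" "f i"] by simp
qed

lemma wiener_shrink:
  assumes "wiener r N f" "0 < s" "s \<le> r"
  shows "wiener s N f"
proof -
  let ?MI = "multi_indices :: ('a \<Rightarrow> nat) set"
  obtain a where a: "expansion a r f" and N: "(\<Sum>\<^sub>\<infinity>\<alpha>\<in>?MI. \<bar>a \<alpha>\<bar> * r ^ mdeg \<alpha>) \<le> N"
    using assms(1) by (auto simp: wiener_def)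
  have le: "\<bar>a \<alpha>\<bar> * s ^ mdeg \<alpha> \<le> \<bar>a \<alpha>\<bar> * r ^ mdeg \<alpha>" for \<alpha>
    using assms by (intro mult_left_mono power_mono) auto
  have r: "(\<lambda>\<alpha>. \<bar>a \<alpha>\<bar> * r ^ mdeg \<alpha>) summable_on ?MI" using a by (simp add: expansion_def)
  have s: "(\<lambda>\<alpha>. \<bar>a \<alpha>\<bar> * s ^ mdeg \<alpha>) summable_on ?MI"
    by (rule summable_on_comparison_test[OF r]) (use le assms in auto)
  have "cube s \<subseteq> (cube r :: 'a set)" using assms by (force simp: cube_def)
  with a s have "expansion a s f" by (auto simp: expansion_def)
  moreover have "(\<Sum>\<^sub>\<infinity>\<alpha>\<in>?MI. \<bar>a \<alpha>\<bar> * s ^ mdeg \<alpha>) \<le> N"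
    using infsum_mono[OF s r le] N by simp
  ultimately show ?thesis by (auto simp: wiener_def)
qed

lemma mono_fun_0: "mono_fun \<alpha> 0 = (if mdeg \<alpha> = 0 then 1 else 0)"
  by (auto simp: mono_fun_def mdeg_def power_0_left)

lemma mdeg_eq_0_iff:
  assumes "\<alpha> \<in> multi_indices"
  shows "mdeg \<alpha> = 0 \<longleftrightarrow> \<alpha> = restrict (\<lambda>_. 0) Basis"
  using assms by (auto simp: mdeg_def PiE_def extensional_def fun_eq_iff)

text \<open>Without a constant term every remaining term has degree at least one, so shrinking the
  radius by \<open>t\<close> gains at least a factor \<open>t\<close>. This makes norms as small as
  inversion and composition require.\<close>

lemma wiener_scale:
  assumes "wiener r N f" "0 < r" "f 0 = 0" "0 < t" "t \<le> 1"
  shows "wiener (t * r) (t * N) f"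
proof -
  let ?MI = "multi_indices :: ('a \<Rightarrow> nat) set"
  obtain a where a: "expansion a r f" and N: "(\<Sum>\<^sub>\<infinity>\<alpha>\<in>?MI. \<bar>a \<alpha>\<bar> * r ^ mdeg \<alpha>) \<le> N"
    using assms(1) by (auto simp: wiener_def)
  let ?z = "restrict (\<lambda>_. 0) Basis :: 'a \<Rightarrow> nat"
  have z: "?z \<in> ?MI" by auto
  \<comment> \<open>At the origin only the constant term survives; summing the series there in two
    ways shows that this term is zero.\<close>
  have "((\<lambda>\<alpha>. a \<alpha> * mono_fun \<alpha> 0) has_sum f 0) ?MI"
    using a assms(2) by (auto simp: expansion_def cube_def)
  moreover have "((\<lambda>\<alpha>. a \<alpha> * mono_fun \<alpha> 0) has_sum a ?z) ?MI"
  proof -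
    have "((\<lambda>\<alpha>. (if \<alpha> = ?z then a ?z else 0) * 1) has_sum a ?z) ?MI"
      using has_sum_single[OF z, of "a ?z" "\<lambda>_. 1"] by simp
    then show ?thesis
      by (rule has_sum_cong[THEN iffD1, rotated]) (auto simp: mono_fun_0 mdeg_eq_0_iff)
  qed
  ultimately have az: "a ?z = 0" using assms(3) has_sum_unique by metis
  have le: "\<bar>a \<alpha>\<bar> * (t * r) ^ mdeg \<alpha> \<le> t * (\<bar>a \<alpha>\<bar> * r ^ mdeg \<alpha>)" if "\<alpha> \<in> ?MI" for \<alpha>
  proof (cases "mdeg \<alpha>")
    case 0
    then show ?thesis using az that mdeg_eq_0_iff by fastforce
  next
    case (Suc n)
    then have "t ^ mdeg \<alpha> \<le> t" using assms power_decreasing[of 1 "mdeg \<alpha>" t] by simp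
    then have "t ^ mdeg \<alpha> * (\<bar>a \<alpha>\<bar> * r ^ mdeg \<alpha>) \<le> t * (\<bar>a \<alpha>\<bar> * r ^ mdeg \<alpha>)"
      using assms by (intro mult_right_mono) auto
    then show ?thesis by (simp add: power_mult_distrib mult_ac)
  qed
  have r: "(\<lambda>\<alpha>. t * (\<bar>a \<alpha>\<bar> * r ^ mdeg \<alpha>)) summable_on ?MI"
    using a by (intro summable_on_cmult_right) (simp add: expansion_def)
  have s: "(\<lambda>\<alpha>. \<bar>a \<alpha>\<bar> * (t * r) ^ mdeg \<alpha>) summable_on ?MI"
    by (rule summable_on_comparison_test[OF r]) (use le assms in auto)
  have "t * r \<le> r" using assms mult_right_mono[of t 1 r] by simp
  then have "cube (t * r) \<subseteq> (cube r :: 'a set)" by (force simp: cube_def)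
  with a s have "expansion a (t * r) f" by (auto simp: expansion_def)
  moreover have "(\<Sum>\<^sub>\<infinity>\<alpha>\<in>?MI. \<bar>a \<alpha>\<bar> * (t * r) ^ mdeg \<alpha>) \<le> t * N"
    by (rule order_trans[OF infsum_mono[OF s r le, unfolded infsum_cmult_right']
          mult_left_mono[OF N less_imp_le[OF assms(4)]]])
  ultimately show ?thesis by (auto simp: wiener_def)
qed

section \<open>Composition and inversion\<close>

text \<open>If the components of \<open>g\<close> have norm at most \<open>R\<close>, then
  substituting \<open>g\<close> into a term of \<open>f\<close> gives norm at most
  \<open>\<bar>a \<alpha>\<bar> * R ^ mdeg \<alpha>\<close>, and these bounds are summable with sum
  at most \<open>M\<close>.\<close>

lemma wiener_compose:
  fixes f :: "'b::euclidean_space \<Rightarrow> real" and g :: "'a::euclidean_space \<Rightarrow> 'b"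
  assumes r: "0 < r" "0 < R" and f: "wiener R M f"
    and g: "\<And>b. b \<in> Basis \<Longrightarrow> wiener r R (\<lambda>x. g x \<bullet> b)"
  shows "wiener r M (\<lambda>x. f (g x))"
proof -
  let ?MI = "multi_indices :: ('b \<Rightarrow> nat) set"
  obtain a where a: "expansion a R f" and M: "(\<Sum>\<^sub>\<infinity>\<alpha>\<in>?MI. \<bar>a \<alpha>\<bar> * R ^ mdeg \<alpha>) \<le> M"
    using f by (auto simp: wiener_def)
  show ?thesis
  proof (rule wiener_has_sum[OF r(1) _ _ M])
    show "wiener r (\<bar>a \<alpha>\<bar> * R ^ mdeg \<alpha>) (\<lambda>x. a \<alpha> * mono_fun \<alpha> (g x))" for \<alpha>
      unfolding mono_fun_def mdeg_def power_sum
      by (intro wiener_mult wiener_const wiener_prod wiener_power g r) auto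
    show "(\<lambda>\<alpha>. \<bar>a \<alpha>\<bar> * R ^ mdeg \<alpha>) summable_on ?MI"
      using a by (simp add: expansion_def)
    show "((\<lambda>\<alpha>. a \<alpha> * mono_fun \<alpha> (g x)) has_sum f (g x)) ?MI" if "x \<in> cube r" for x
    proof -
      have "g x \<in> cube R" using wiener_abs_le[OF g that] by (auto simp: cube_def)
      with a show ?thesis by (simp add: expansion_def)
    qed
  qed
qed

text \<open>Neumann series: \<open>f = f 0 * (1 - g)\<close> with \<open>g 0 = 0\<close>, and
  \<open>1 / (1 - g)\<close> is a geometric series as soon as the radius is small enough for
  \<open>g\<close> to have norm below one.\<close>

lemma wiener_inverse:
  assumes r: "0 < r" and f: "wiener r N f" and f0: "f 0 \<noteq> 0"
  shows "\<exists>s>0. \<exists>M. wiener s M (\<lambda>x. inverse (f x))"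
proof -
  define g where "g x = 1 + (- 1 / f 0) * f x" for x
  define N' where "N' = \<bar>1\<bar> + \<bar>- 1 / f 0\<bar> * N"
  have g: "wiener r N' g"
    unfolding g_def N'_def by (intro wiener_add wiener_mult wiener_const r f)
  have N': "1 \<le> N'" using wiener_nonneg[OF _ f] r by (simp add: N'_def)
  \<comment> \<open>Chosen so that scaling the radius by \<open>t\<close> brings the norm bound
    \<open>N'\<close> of \<open>g\<close> down to \<open>1 / 2\<close>.\<close>
  define t where "t = 1 / (2 * N')"
  have t: "0 < t" "t \<le> 1" "t * N' = 1 / 2" using N' by (auto simp: t_def)
  define s where "s = t * r"
  have s: "0 < s" using t r by (simp add: s_def)
  have gs: "wiener s (1 / 2) g"
    using wiener_scale[OF g r _ t(1,2)] f0 by (simp add: s_def t(3) g_def)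
  have geo: "((\<lambda>n. c ^ n) has_sum 1 / (1 - c)) UNIV" if "\<bar>c\<bar> < 1" for c :: real
    using that geometric_sums[of c]
    by (intro norm_summable_imp_has_sum) (auto simp: power_abs intro!: summable_geometric)
  have half: "((\<lambda>n. (1 / 2) ^ n) has_sum (2::real)) UNIV" using geo[of "1 / 2"] by simp
  have "wiener s 2 (\<lambda>x. 1 / (1 - g x))"
  proof (rule wiener_has_sum[OF s wiener_power[OF s gs]])
    show "(\<lambda>n. (1 / 2 :: real) ^ n) summable_on UNIV" using half by (rule has_sum_imp_summable)
    show "(\<Sum>\<^sub>\<infinity>n. (1 / 2 :: real) ^ n) \<le> 2" using infsumI[OF half] by simp
    show "((\<lambda>n. g x ^ n) has_sum 1 / (1 - g x)) UNIV" if "x \<in> cube s" for x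
      using wiener_abs_le[OF gs that] by (intro geo) simp
  qed
  then have "wiener s (\<bar>1 / f 0\<bar> * 2) (\<lambda>x. 1 / f 0 * (1 / (1 - g x)))"
    by (intro wiener_mult wiener_const s)
  then have "wiener s (\<bar>1 / f 0\<bar> * 2) (\<lambda>x. inverse (f x))"
    by (rule wiener_cong) (use f0 in \<open>simp add: g_def field_simps\<close>)
  with s show ?thesis by blast
qed

section \<open>Term-by-term differentiation\<close>

text \<open>The direction is arbitrary so that one notion serves both for \<open>(u, w)\<close> and
  for \<open>(x, y, w, E)\<close>. The direction 0 also occurs, for jet coordinates that do not move
  the base point.\<close>

definition pd :: "'a::euclidean_space \<Rightarrow> ('a \<Rightarrow> real) \<Rightarrow> 'a \<Rightarrow> real" where
  "pd b f x = deriv (\<lambda>t. f (x + t *\<^sub>R b)) 0"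

definition deriv_coeff ::
  "'a \<Rightarrow> (('a::euclidean_space \<Rightarrow> nat) \<Rightarrow> real) \<Rightarrow> ('a \<Rightarrow> nat) \<Rightarrow> real" where
  "deriv_coeff b a \<beta> = real (\<beta> b + 1) * a (\<beta>(b := \<beta> b + 1))"

lemma countable_multi_indices: "countable (multi_indices :: ('a::euclidean_space \<Rightarrow> nat) set)"
  by (intro countable_PiE) auto

lemma infinite_multi_indices: "infinite (multi_indices :: ('a::euclidean_space \<Rightarrow> nat) set)"
proof -
  have "inj (\<lambda>n. restrict (\<lambda>_. n) Basis :: 'a \<Rightarrow> nat)"
    by (rule injI) (metis SOME_Basis restrict_apply')
  then have "infinite (range (\<lambda>n. restrict (\<lambda>_. n) Basis :: 'a \<Rightarrow> nat))"
    by (rule range_inj_infinite)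
  then show ?thesis by (rule infinite_super[rotated]) auto
qed

lemma mono_fun_remove:
  assumes "b \<in> Basis"
  shows "mono_fun \<alpha> x = (x \<bullet> b) ^ \<alpha> b * (\<Prod>c\<in>Basis - {b}. (x \<bullet> c) ^ \<alpha> c)"
  unfolding mono_fun_def by (rule prod.remove) (use assms in auto)

text \<open>When \<open>\<alpha> b = 0\<close> the truncated exponent \<open>\<alpha> b - 1\<close>
  is harmless, since the factor in front vanishes.\<close>

lemma mono_fun_has_derivative:
  assumes b: "b \<in> Basis"
  shows "((\<lambda>t. mono_fun \<alpha> (x + t *\<^sub>R b)) has_real_derivative
           real (\<alpha> b) * mono_fun (\<alpha>(b := \<alpha> b - 1)) (x + t *\<^sub>R b)) (at t)"
proof -
  have c: "(x + t *\<^sub>R b) \<bullet> c = x \<bullet> c" if "c \<in> Basis - {b}" for t c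
    using that b by (auto simp: inner_add_left inner_not_same_Basis)
  have P: "(\<Prod>c\<in>Basis - {b}. ((x + t *\<^sub>R b) \<bullet> c) ^ \<beta> c) = (\<Prod>c\<in>Basis - {b}. (x \<bullet> c) ^ \<beta> c)"
    for t \<beta> by (rule prod.cong) (use c in auto)
  have U: "(\<Prod>c\<in>Basis - {b}. (x \<bullet> c) ^ (\<alpha>(b := n)) c) = (\<Prod>c\<in>Basis - {b}. (x \<bullet> c) ^ \<alpha> c)" for n
    by (rule prod.cong) auto
  have B: "(x + t *\<^sub>R b) \<bullet> b = x \<bullet> b + t" for t
    using b by (simp add: inner_add_left)
  show ?thesis
    unfolding mono_fun_remove[OF b] P U B
    by (rule derivative_eq_intros refl | simp)+
qed

lemma mdeg_upd:
  assumes "b \<in> Basis"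
  shows "mdeg (\<alpha>(b := n)) + \<alpha> b = mdeg \<alpha> + n"
proof -
  have "mdeg \<beta> = \<beta> b + (\<Sum>c\<in>Basis - {b}. \<beta> c)" for \<beta> :: "'a \<Rightarrow> nat"
    unfolding mdeg_def by (rule sum.remove) (use assms in auto)
  moreover have "(\<Sum>c\<in>Basis - {b}. (\<alpha>(b := n)) c) = (\<Sum>c\<in>Basis - {b}. \<alpha> c)"
    by (rule sum.cong) auto
  ultimately show ?thesis by simp
qed

text \<open>The factor \<open>m\<close> produced by differentiation is absorbed by halving the
  radius, because \<open>m \<le> n < 2 ^ n\<close>.\<close>

lemma mult_half_power_le:
  fixes r :: real
  assumes "0 < r" "m \<le> n"
  shows "real m * (r / 2) ^ (n - 1) \<le> 2 / r * r ^ n"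
proof (cases n)
  case (Suc k)
  have "m \<le> 2 ^ n" using le_less_trans[OF assms(2) less_exp[of n]] by (rule less_imp_le)
  then have "real m \<le> real (2 ^ n)" by (rule of_nat_mono)
  then have "real m \<le> 2 ^ n" by simp
  then have "real m * (r / 2) ^ n \<le> 2 ^ n * (r / 2) ^ n"
    using assms by (intro mult_right_mono) auto
  also have "\<dots> = r ^ n" by (simp add: power_divide)
  finally have "2 / r * (real m * (r / 2) ^ n) \<le> 2 / r * r ^ n"
    using assms by (intro mult_left_mono) auto
  also have "2 / r * (real m * (r / 2) ^ n) = real m * (r / 2) ^ (n - 1)"
    using assms by (simp add: Suc field_simps)
  finally show ?thesis .
qed (use assms in auto)

text \<open>Enumerating the index set by the naturals reduces the claim to termwise differentiation
  of an ordinary series; the majorant \<open>M\<close> gives uniform convergence of the derivatives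
  by the Weierstrass test.\<close>

lemma has_real_derivative_infsum:
  fixes F :: "'i \<Rightarrow> real \<Rightarrow> real"
  assumes I: "countable I" "infinite I" and e: "0 < e"
    and F: "\<And>i t. i \<in> I \<Longrightarrow> \<bar>t\<bar> \<le> e \<Longrightarrow> (F i has_real_derivative F' i t) (at t)"
    and M: "\<And>i t. i \<in> I \<Longrightarrow> \<bar>t\<bar> \<le> e \<Longrightarrow> \<bar>F' i t\<bar> \<le> M i" "M summable_on I"
    and f: "\<And>t. \<bar>t\<bar> \<le> e \<Longrightarrow> ((\<lambda>i. F i t) has_sum f t) I"
  shows "(f has_real_derivative (\<Sum>\<^sub>\<infinity>i\<in>I. F' i 0)) (at 0)"
proof -
  obtain h :: "nat \<Rightarrow> 'i" where h: "bij_betw h UNIV I"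
    using countableE_infinite[OF I] bij_betw_inv_into by metis
  then have hI: "h n \<in> I" for n by (auto simp: bij_betw_def)
  have sums: "(\<lambda>n. F (h n) t) sums f t" if "\<bar>t\<bar> \<le> e" for t
    using f[OF that] has_sum_reindex_bij_betw[OF h, of "\<lambda>i. F i t" "f t"]
    by (intro has_sum_imp_sums) simp
  have "(\<lambda>n. M (h n)) summable_on UNIV"
    using M(2) summable_on_reindex_bij_betw[OF h, of M] by simp
  then have Msum: "summable (\<lambda>n. M (h n))" by (rule summable_on_imp_summable)
  have "((\<lambda>t. \<Sum>n. F (h n) t) has_real_derivative (\<Sum>n. F' (h n) 0)) (at 0)"
  proof (rule has_field_derivative_series'(2)[where S = "{-e..e}" and x0 = 0
          and f = "\<lambda>n. F (h n)" and f' = "\<lambda>n. F' (h n)"])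
    show "(F (h n) has_real_derivative F' (h n) t) (at t within {-e..e})" if "t \<in> {-e..e}" for n t
      by (rule has_field_derivative_at_within, rule F[OF hI]) (use that in auto)
    show "uniformly_convergent_on {-e..e} (\<lambda>n t. \<Sum>i<n. F' (h i) t)"
      by (rule Weierstrass_m_test'[OF _ Msum]) (use M(1)[OF hI] in auto)
    show "summable (\<lambda>n. F (h n) 0)" using sums[of 0] e by (auto simp: sums_iff)
  qed (use e in \<open>auto simp: interior_atLeastAtMost_real\<close>)
  moreover have "(\<lambda>i. F' i 0) summable_on I"
    by (rule iffD2[OF summable_on_iff_abs_summable_on_real],
        rule summable_on_comparison_test[OF M(2)]) (use M(1)[of _ 0] e in auto)
  then have "((\<lambda>n. F' (h n) 0) has_sum (\<Sum>\<^sub>\<infinity>i\<in>I. F' i 0)) UNIV"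
    using has_sum_reindex_bij_betw[OF h, of "\<lambda>i. F' i 0"] by (simp add: has_sum_infsum)
  then have "(\<Sum>n. F' (h n) 0) = (\<Sum>\<^sub>\<infinity>i\<in>I. F' i 0)"
    using has_sum_imp_sums sums_unique by metis
  ultimately have "((\<lambda>t. \<Sum>n. F (h n) t) has_real_derivative (\<Sum>\<^sub>\<infinity>i\<in>I. F' i 0)) (at 0)" by simp
  then show ?thesis
    by (rule has_field_derivative_transform_within_open[where S = "{-e<..<e}"])
      (use e sums in \<open>auto simp: sums_iff\<close>)
qed

text \<open>One halving of the radius absorbs the exponents brought down by differentiation. A
  second one leaves room to move along \<open>b\<close>: points of the cube \<open>r / 4\<close>
  stay in the cube \<open>r / 2\<close> for parameters up to \<open>r / 4\<close>.\<close>

lemma expansion_has_derivative: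
  fixes f :: "'a::euclidean_space \<Rightarrow> real"
  assumes r: "0 < r" and a: "expansion a r f" and b: "b \<in> Basis"
  obtains f' where "expansion (deriv_coeff b a) (r / 4) f'"
    and "\<And>x. x \<in> cube (r / 4) \<Longrightarrow> ((\<lambda>t. f (x + t *\<^sub>R b)) has_real_derivative f' x) (at 0)"
proof -
  let ?MI = "multi_indices :: ('a \<Rightarrow> nat) set"
  define d where "d \<alpha> x = real (\<alpha> b) * mono_fun (\<alpha>(b := \<alpha> b - 1)) x" for \<alpha> and x :: 'a
  define M where "M \<alpha> = \<bar>a \<alpha>\<bar> * (2 / r * r ^ mdeg \<alpha>)" for \<alpha>
  define f' where "f' x = (\<Sum>\<^sub>\<infinity>\<alpha>\<in>?MI. a \<alpha> * d \<alpha> x)" for x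
  have num: "real (\<alpha> b) * (r / 2) ^ mdeg (\<alpha>(b := \<alpha> b - 1)) \<le> 2 / r * r ^ mdeg \<alpha>" for \<alpha>
  proof (cases "\<alpha> b")
    case 0
    then show ?thesis using r by simp
  next
    case (Suc n)
    have "\<alpha> b \<le> mdeg \<alpha>" "mdeg (\<alpha>(b := \<alpha> b - 1)) = mdeg \<alpha> - 1"
      using mdeg_upd[OF b, of \<alpha> "\<alpha> b - 1"] mdeg_upd[OF b, of \<alpha> 0] Suc by auto
    then show ?thesis using mult_half_power_le[OF r, of "\<alpha> b" "mdeg \<alpha>"] by simp
  qed
  have M: "\<bar>a \<alpha> * d \<alpha> x\<bar> \<le> M \<alpha>" if "x \<in> cube (r / 2)" for \<alpha> x
  proof -
    have "\<bar>d \<alpha> x\<bar> \<le> real (\<alpha> b) * (r / 2) ^ mdeg (\<alpha>(b := \<alpha> b - 1))"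
      unfolding d_def abs_mult using abs_mono_fun_le[OF that] by (simp add: mult_left_mono)
    also note num
    finally show ?thesis
      unfolding M_def abs_mult by (rule mult_left_mono) simp
  qed
  have Msum: "M summable_on ?MI"
  proof -
    have "(\<lambda>\<alpha>. 2 / r * (\<bar>a \<alpha>\<bar> * r ^ mdeg \<alpha>)) summable_on ?MI"
      using a by (intro summable_on_cmult_right) (simp add: expansion_def)
    then show ?thesis by (simp add: M_def[abs_def] mult_ac)
  qed
  have near: "x + t *\<^sub>R b \<in> cube (r / 2)" if "x \<in> cube (r / 4)" "\<bar>t\<bar> \<le> r / 4" for x t
  proof -
    have "\<bar>(x + t *\<^sub>R b) \<bullet> c\<bar> \<le> r / 2" if c: "c \<in> Basis" for c
    proof -
      have "\<bar>(x + t *\<^sub>R b) \<bullet> c\<bar> \<le> \<bar>x \<bullet> c\<bar> + \<bar>t\<bar> * \<bar>b \<bullet> c\<bar>"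
        by (simp add: inner_add_left abs_mult[symmetric] abs_triangle_ineq)
      also have "\<dots> \<le> r / 4 + r / 4 * 1"
        using \<open>x \<in> cube (r / 4)\<close> \<open>\<bar>t\<bar> \<le> r / 4\<close> b c
        by (intro add_mono mult_mono) (auto simp: cube_def inner_Basis)
      finally show ?thesis by simp
    qed
    then show ?thesis by (simp add: cube_def)
  qed
  have sub: "cube (r / 2) \<subseteq> (cube r :: 'a set)" "cube (r / 4) \<subseteq> (cube (r / 2) :: 'a set)"
    using r by (force simp: cube_def)+
  have deriv: "((\<lambda>t. f (x + t *\<^sub>R b)) has_real_derivative f' x) (at 0)"
    if x: "x \<in> cube (r / 4)" for x
  proof -
    have "((\<lambda>t. f (x + t *\<^sub>R b)) has_real_derivative
            (\<Sum>\<^sub>\<infinity>\<alpha>\<in>?MI. a \<alpha> * d \<alpha> (x + 0 *\<^sub>R b))) (at 0)"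
    proof (rule has_real_derivative_infsum[OF countable_multi_indices infinite_multi_indices,
            where e = "r / 4" and M = M and F = "\<lambda>\<alpha> t. a \<alpha> * mono_fun \<alpha> (x + t *\<^sub>R b)"])
      show "((\<lambda>t. a \<alpha> * mono_fun \<alpha> (x + t *\<^sub>R b)) has_real_derivative a \<alpha> * d \<alpha> (x + t *\<^sub>R b)) (at t)"
        for \<alpha> t unfolding d_def by (rule DERIV_cmult[OF mono_fun_has_derivative[OF b]])
      show "((\<lambda>\<alpha>. a \<alpha> * mono_fun \<alpha> (x + t *\<^sub>R b)) has_sum f (x + t *\<^sub>R b)) ?MI" if "\<bar>t\<bar> \<le> r / 4" for t
        using a near[OF x that] sub by (auto simp: expansion_def)
    qed (use r M near[OF x] Msum in auto)
    then show ?thesis by (simp add: f'_def)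
  qed
  \<comment> \<open>Monomials with \<open>\<alpha> b = 0\<close> have derivative zero; raising the
    exponent of \<open>b\<close> by one enumerates all the others and turns the differentiated
    series into a power series.\<close>
  have bij: "bij_betw (\<lambda>\<beta>. \<beta>(b := \<beta> b + 1)) ?MI {\<alpha> \<in> ?MI. \<alpha> b \<noteq> 0}"
    by (rule bij_betwI[where g = "\<lambda>\<alpha>. \<alpha>(b := \<alpha> b - 1)"])
      (use b in \<open>auto simp: PiE_def extensional_def fun_eq_iff\<close>)
  have "(\<lambda>\<beta>. \<bar>deriv_coeff b a \<beta>\<bar> * (r / 4) ^ mdeg \<beta>) summable_on ?MI"
  proof (rule summable_on_comparison_test)
    have "M summable_on {\<alpha> \<in> ?MI. \<alpha> b \<noteq> 0}" using Msum by (rule summable_on_subset) auto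
    then show "(\<lambda>\<beta>. M (\<beta>(b := \<beta> b + 1))) summable_on ?MI"
      using summable_on_reindex_bij_betw[OF bij, of M] by simp
    show "\<bar>deriv_coeff b a \<beta>\<bar> * (r / 4) ^ mdeg \<beta> \<le> M (\<beta>(b := \<beta> b + 1))" for \<beta>
    proof -
      let ?\<alpha> = "\<beta>(b := \<beta> b + 1)"
      have "\<bar>deriv_coeff b a \<beta>\<bar> * (r / 4) ^ mdeg \<beta> = \<bar>a ?\<alpha>\<bar> * (real (?\<alpha> b) * (r / 4) ^ mdeg \<beta>)"
        by (simp add: deriv_coeff_def abs_mult)
      also have "\<dots> \<le> \<bar>a ?\<alpha>\<bar> * (real (?\<alpha> b) * (r / 2) ^ mdeg \<beta>)"
        using r by (intro mult_left_mono power_mono) auto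
      also have "\<dots> \<le> M ?\<alpha>"
        unfolding M_def using num[of ?\<alpha>] by (intro mult_left_mono) auto
      finally show ?thesis .
    qed
  qed (use r in auto)
  moreover have "((\<lambda>\<beta>. deriv_coeff b a \<beta> * mono_fun \<beta> x) has_sum f' x) ?MI" if x: "x \<in> cube (r / 4)" for x
  proof -
    have "(\<lambda>\<alpha>. a \<alpha> * d \<alpha> x) summable_on ?MI"
      by (rule iffD2[OF summable_on_iff_abs_summable_on_real],
          rule summable_on_comparison_test[OF Msum]) (use M x sub in auto)
    then have "((\<lambda>\<alpha>. a \<alpha> * d \<alpha> x) has_sum f' x) ?MI" by (simp add: f'_def has_sum_infsum)
    then have "((\<lambda>\<alpha>. a \<alpha> * d \<alpha> x) has_sum f' x) {\<alpha> \<in> ?MI. \<alpha> b \<noteq> 0}"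
      by (rule has_sum_cong_neutral[THEN iffD1, rotated -1]) (auto simp: d_def)
    then have "((\<lambda>\<beta>. a (\<beta>(b := \<beta> b + 1)) * d (\<beta>(b := \<beta> b + 1)) x) has_sum f' x) ?MI"
      using has_sum_reindex_bij_betw[OF bij, of "\<lambda>\<alpha>. a \<alpha> * d \<alpha> x"] by simp
    then show ?thesis by (simp add: d_def deriv_coeff_def mult_ac)
  qed
  ultimately have "expansion (deriv_coeff b a) (r / 4) f'" by (simp add: expansion_def)
  with deriv show ?thesis using that by blast
qed

lemma expansion_pd:
  assumes r: "0 < r" and a: "expansion a r (\<lambda>x. f (p + x))" and b: "b \<in> Basis"
  shows "expansion (deriv_coeff b a) (r / 4) (\<lambda>x. pd b f (p + x))"
    and "((\<lambda>t. f (p + t *\<^sub>R b)) has_real_derivative pd b f p) (at 0)"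
proof -
  obtain f' where f': "expansion (deriv_coeff b a) (r / 4) f'"
    and d: "\<And>x. x \<in> cube (r / 4) \<Longrightarrow>
              ((\<lambda>t. f (p + (x + t *\<^sub>R b))) has_real_derivative f' x) (at 0)"
    using expansion_has_derivative[OF r a b] by blast
  have eq: "pd b f (p + x) = f' x" if "x \<in> cube (r / 4)" for x
    using DERIV_imp_deriv[OF d[OF that]] by (simp add: pd_def add.assoc)
  show "expansion (deriv_coeff b a) (r / 4) (\<lambda>x. pd b f (p + x))"
    using f' eq by (simp add: expansion_def)
  show "((\<lambda>t. f (p + t *\<^sub>R b)) has_real_derivative pd b f p) (at 0)"
    using d[of 0] eq[of 0] r by (simp add: cube_def)
qed

section \<open>Real analytic functions\<close>

lemma cube_subset_ball:
  assumes "0 < \<rho>"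
  shows "cube (\<rho> / (2 * DIM('a))) \<subseteq> ball (0 :: 'a::euclidean_space) \<rho>"
proof
  fix x :: 'a assume x: "x \<in> cube (\<rho> / (2 * DIM('a)))"
  have "norm x \<le> (\<Sum>b\<in>Basis. \<bar>x \<bullet> b\<bar>)" by (rule norm_le_l1)
  also have "\<dots> \<le> (\<Sum>b\<in>(Basis :: 'a set). \<rho> / (2 * DIM('a)))"
    using x by (intro sum_mono) (auto simp: cube_def)
  \<comment> \<open>The factor 2 in the side length makes this inequality strict.\<close>
  also have "\<dots> < \<rho>" using assms by simp
  finally show "x \<in> ball 0 \<rho>" by simp
qed

lemma ball_subset_cube: "ball (0 :: 'a::euclidean_space) r \<subseteq> cube r"
proof
  fix x :: 'a assume "x \<in> ball 0 r"
  then show "x \<in> cube r"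
    unfolding cube_def using Basis_le_norm[of _ x] by (auto intro: order_trans less_imp_le)
qed

text \<open>Convergence in the sense of \<open>has_sum\<close> is absolute for real terms. Hence
  convergence at the corner of a small cube already bounds the weighted norm.\<close>

lemma real_analytic_on_iff_expansion:
  fixes f :: "'a::euclidean_space \<Rightarrow> real"
  shows "real_analytic_on f S \<longleftrightarrow> (\<forall>p\<in>S. \<exists>r>0. \<exists>a. expansion a r (\<lambda>x. f (p + x)))"
proof -
  have "(\<exists>r>0. \<exists>a. \<forall>q\<in>ball p r. ((\<lambda>\<alpha>. a \<alpha> * mono_fun \<alpha> (q - p)) has_sum f q) multi_indices) \<longleftrightarrow>
        (\<exists>r>0. \<exists>a. expansion a r (\<lambda>x. f (p + x)))" (is "?L \<longleftrightarrow> ?R") for p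
  proof
    assume ?L
    then obtain \<rho> a where \<rho>: "0 < \<rho>" and
      a: "\<And>q. q \<in> ball p \<rho> \<Longrightarrow> ((\<lambda>\<alpha>. a \<alpha> * mono_fun \<alpha> (q - p)) has_sum f q) multi_indices" by blast
    define s where "s = \<rho> / (2 * DIM('a))"
    have s: "0 < s" using \<rho> by (simp add: s_def)
    have ser: "((\<lambda>\<alpha>. a \<alpha> * mono_fun \<alpha> x) has_sum f (p + x)) multi_indices" if "x \<in> cube s" for x
    proof -
      have "p + x \<in> ball p \<rho>" using that cube_subset_ball[OF \<rho>] by (auto simp: s_def dist_norm)
      from a[OF this] show ?thesis by simp
    qed
    \<comment> \<open>The corner of the cube, where each monomial equals its weight.\<close>
    define x where "x = (\<Sum>b\<in>Basis. s *\<^sub>R (b :: 'a))"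
    have x: "x \<bullet> b = s" if "b \<in> Basis" for b using that by (simp add: x_def)
    then have "mono_fun \<alpha> x = s ^ mdeg \<alpha>" for \<alpha>
      by (simp add: mono_fun_def mdeg_def power_sum)
    moreover have "x \<in> cube s" using x s by (simp add: cube_def)
    ultimately have "(\<lambda>\<alpha>. a \<alpha> * s ^ mdeg \<alpha>) summable_on multi_indices"
      using has_sum_imp_summable[OF ser[of x]] by simp
    then have "(\<lambda>\<alpha>. \<bar>a \<alpha>\<bar> * s ^ mdeg \<alpha>) summable_on multi_indices"
      using s iffD1[OF summable_on_iff_abs_summable_on_real, of "\<lambda>\<alpha>. a \<alpha> * s ^ mdeg \<alpha>"]
      by (simp add: abs_mult)
    with ser s show ?R by (auto simp: expansion_def)
  next
    assume ?R
    then obtain r a where "0 < r" and a: "expansion a r (\<lambda>x. f (p + x))" by auto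
    have "((\<lambda>\<alpha>. a \<alpha> * mono_fun \<alpha> (q - p)) has_sum f q) multi_indices" if "q \<in> ball p r" for q
    proof -
      have "q - p \<in> cube r"
        using that ball_subset_cube[of r] by (auto simp: dist_norm norm_minus_commute)
      then have "((\<lambda>\<alpha>. a \<alpha> * mono_fun \<alpha> (q - p)) has_sum f (p + (q - p))) multi_indices"
        using a unfolding expansion_def by blast
      then show ?thesis by simp
    qed
    with \<open>0 < r\<close> show ?L by blast
  qed
  then show ?thesis by (simp add: real_analytic_on_def mono_fun_def)
qed

lemma real_analytic_on_iff_wiener:
  "real_analytic_on f S \<longleftrightarrow> (\<forall>p\<in>S. \<exists>r>0. \<exists>N. wiener r N (\<lambda>x. f (p + x)))"
  unfolding real_analytic_on_iff_expansion wiener_def by blast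

section \<open>Partial derivatives of analytic functions\<close>

lemma real_analytic_on_has_pd:
  assumes "real_analytic_on f S" "p \<in> S" "b \<in> Basis"
  shows "((\<lambda>t. f (p + t *\<^sub>R b)) has_real_derivative pd b f p) (at 0)"
  using assms expansion_pd(2) unfolding real_analytic_on_iff_expansion by blast

lemma real_analytic_on_pd:
  assumes "real_analytic_on f S" "b \<in> Basis"
  shows "real_analytic_on (pd b f) S"
  unfolding real_analytic_on_iff_expansion
proof
  fix p assume "p \<in> S"
  then obtain r a where r: "0 < r" "expansion a r (\<lambda>x. f (p + x))"
    using assms(1) unfolding real_analytic_on_iff_expansion by blast
  show "\<exists>r>0. \<exists>a. expansion a r (\<lambda>x. pd b f (p + x))"
    using expansion_pd(1)[OF r assms(2)] r(1) by (intro exI[of _ "r / 4"]) auto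
qed

text \<open>For \<open>b \<noteq> c\<close> the formal derivatives act on different exponents and
  commute on coefficients. Both iterated derivatives are then sums of the same series at
  \<open>p\<close>.\<close>

lemma pd_commute:
  fixes f :: "'a::euclidean_space \<Rightarrow> real"
  assumes "real_analytic_on f S" "p \<in> S" "b \<in> Basis" "c \<in> Basis"
  shows "pd b (pd c f) p = pd c (pd b f) p"
proof (cases "b = c")
  case False
  obtain r a where r: "0 < r" "expansion a r (\<lambda>x. f (p + x))"
    using assms unfolding real_analytic_on_iff_expansion by blast
  have r4: "0 < r / 4" and r16: "(0 :: 'a) \<in> cube (r / 4 / 4)" using r by (auto simp: cube_def)
  have "deriv_coeff b (deriv_coeff c a) = deriv_coeff c (deriv_coeff b a)"
    using False by (auto simp: deriv_coeff_def fun_eq_iff fun_upd_twist)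
  moreover have "((\<lambda>\<alpha>. deriv_coeff b (deriv_coeff c a) \<alpha> * mono_fun \<alpha> 0) has_sum pd b (pd c f) (p + 0))
      multi_indices"
    using expansion_pd(1)[OF r4 expansion_pd(1)[OF r assms(4)] assms(3)] r16
    unfolding expansion_def by blast
  moreover have "((\<lambda>\<alpha>. deriv_coeff c (deriv_coeff b a) \<alpha> * mono_fun \<alpha> 0) has_sum pd c (pd b f) (p + 0))
      multi_indices"
    using expansion_pd(1)[OF r4 expansion_pd(1)[OF r assms(3)] assms(4)] r16
    unfolding expansion_def by blast
  ultimately have "pd b (pd c f) (p + 0) = pd c (pd b f) (p + 0)"
    using has_sum_unique by metis
  then show ?thesis by simp
qed simp

section \<open>Locality and closure properties of analyticity\<close>

text \<open>The expansion at \<open>p\<close> concerns a whole neighbourhood of \<open>p\<close>;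
  openness lets it be shrunk to a cube that stays inside \<open>S\<close>.\<close>

lemma real_analytic_on_cong:
  fixes f :: "'a::euclidean_space \<Rightarrow> real"
  assumes f: "real_analytic_on f S" and S: "open S" and fg: "\<And>x. x \<in> S \<Longrightarrow> f x = g x"
  shows "real_analytic_on g S"
  unfolding real_analytic_on_iff_wiener
proof
  fix p assume p: "p \<in> S"
  then obtain r N where r: "0 < r" "wiener r N (\<lambda>x. f (p + x))"
    using f unfolding real_analytic_on_iff_wiener by blast
  obtain e where e: "0 < e" "ball p e \<subseteq> S" using p S open_contains_ball by blast
  define s where "s = min r (e / (2 * DIM('a)))"
  have s: "0 < s" "s \<le> r" using r e by (auto simp: s_def)
  have "wiener s N (\<lambda>x. g (p + x))"
  proof (rule wiener_cong[OF wiener_shrink[OF r(2) s]])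
    fix x :: 'a assume "x \<in> cube s"
    then have "x \<in> cube (e / (2 * DIM('a)))" by (auto simp: cube_def s_def)
    then have "x \<in> ball 0 e" using cube_subset_ball[OF e(1), where 'a = 'a] by blast
    then have "p + x \<in> S" using e(2) by (auto simp: dist_norm)
    then show "f (p + x) = g (p + x)" by (rule fg)
  qed
  with s show "\<exists>r>0. \<exists>N. wiener r N (\<lambda>x. g (p + x))" by blast
qed

lemma real_analytic_on_const: "real_analytic_on (\<lambda>_. c) S"
  unfolding real_analytic_on_iff_wiener using wiener_const zero_less_one by blast

lemma real_analytic_on_add:
  assumes "real_analytic_on f S" "real_analytic_on g S"
  shows "real_analytic_on (\<lambda>x. f x + g x) S"
  unfolding real_analytic_on_iff_wiener
proof
  fix p assume "p \<in> S"
  then obtain r N s M where "0 < r" "wiener r N (\<lambda>x. f (p + x))" "0 < s" "wiener s M (\<lambda>x. g (p + x))"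
    using assms unfolding real_analytic_on_iff_wiener by meson
  then have "0 < min r s" "wiener (min r s) (N + M) (\<lambda>x. f (p + x) + g (p + x))"
    using wiener_shrink[of r N "\<lambda>x. f (p + x)" "min r s"] wiener_shrink[of s M "\<lambda>x. g (p + x)" "min r s"]
    by (simp_all add: wiener_add)
  then show "\<exists>r>0. \<exists>N. wiener r N (\<lambda>x. f (p + x) + g (p + x))" by blast
qed

lemma real_analytic_on_mult:
  assumes "real_analytic_on f S" "real_analytic_on g S"
  shows "real_analytic_on (\<lambda>x. f x * g x) S"
  unfolding real_analytic_on_iff_wiener
proof
  fix p assume "p \<in> S"
  then obtain r N s M where "0 < r" "wiener r N (\<lambda>x. f (p + x))" "0 < s" "wiener s M (\<lambda>x. g (p + x))"
    using assms unfolding real_analytic_on_iff_wiener by meson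
  then have "0 < min r s" "wiener (min r s) (N * M) (\<lambda>x. f (p + x) * g (p + x))"
    using wiener_shrink[of r N "\<lambda>x. f (p + x)" "min r s"] wiener_shrink[of s M "\<lambda>x. g (p + x)" "min r s"]
    by (simp_all add: wiener_mult)
  then show "\<exists>r>0. \<exists>N. wiener r N (\<lambda>x. f (p + x) * g (p + x))" by blast
qed

lemma real_analytic_on_inner:
  assumes "b \<in> Basis"
  shows "real_analytic_on (\<lambda>x. x \<bullet> b) S"
  unfolding real_analytic_on_iff_wiener
proof
  fix p
  have "wiener 1 (\<bar>p \<bullet> b\<bar> + 1) (\<lambda>x. p \<bullet> b + x \<bullet> b)"
    by (intro wiener_add wiener_const wiener_inner assms) simp
  then show "\<exists>r>0. \<exists>N. wiener r N (\<lambda>x. (p + x) \<bullet> b)"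
    unfolding inner_add_left using zero_less_one by blast
qed

lemma real_analytic_on_inverse:
  assumes "real_analytic_on f S" "\<And>x. x \<in> S \<Longrightarrow> f x \<noteq> 0"
  shows "real_analytic_on (\<lambda>x. inverse (f x)) S"
  unfolding real_analytic_on_iff_wiener
proof
  fix p assume p: "p \<in> S"
  then obtain r N where "0 < r" "wiener r N (\<lambda>x. f (p + x))"
    using assms(1) unfolding real_analytic_on_iff_wiener by blast
  then show "\<exists>r>0. \<exists>N. wiener r N (\<lambda>x. inverse (f (p + x)))"
    using assms(2)[OF p] by (intro wiener_inverse) auto
qed

lemma real_analytic_on_divide:
  assumes "real_analytic_on f S" "real_analytic_on g S" "\<And>x. x \<in> S \<Longrightarrow> g x \<noteq> 0"
  shows "real_analytic_on (\<lambda>x. f x / g x) S"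
  unfolding divide_inverse by (intro real_analytic_on_mult real_analytic_on_inverse assms)

lemma real_analytic_on_compose:
  fixes f :: "'b::euclidean_space \<Rightarrow> real" and g :: "'a::euclidean_space \<Rightarrow> 'b"
  assumes f: "real_analytic_on f T" and gT: "\<And>x. x \<in> S \<Longrightarrow> g x \<in> T"
    and g: "\<And>b. b \<in> Basis \<Longrightarrow> real_analytic_on (\<lambda>x. g x \<bullet> b) S"
  shows "real_analytic_on (\<lambda>x. f (g x)) S"
  unfolding real_analytic_on_iff_wiener
proof
  fix p assume p: "p \<in> S"
  obtain R M where R: "0 < R" and fM: "wiener R M (\<lambda>y. f (g p + y))"
    using f gT[OF p] unfolding real_analytic_on_iff_wiener by blast
  have "\<exists>s>0. wiener s R (\<lambda>x. (g (p + x) - g p) \<bullet> b)" if b: "b \<in> Basis" for b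
  proof -
    have "real_analytic_on (\<lambda>x. g x \<bullet> b + - (g p \<bullet> b)) S"
      by (intro real_analytic_on_add real_analytic_on_const g b)
    then obtain r N where r: "0 < r" and N: "wiener r N (\<lambda>x. (g (p + x) - g p) \<bullet> b)"
      using p unfolding real_analytic_on_iff_wiener inner_diff_left by auto
    \<comment> \<open>The displacement \<open>g (p + x) - g p\<close> vanishes at 0, so scaling by
      \<open>t\<close> brings its norm below \<open>R\<close>; the denominator \<open>N + 1\<close>
      is positive even when \<open>N = 0\<close>.\<close>
    define t where "t = min 1 (R / (N + 1))"
    have N0: "0 \<le> N" using wiener_nonneg[OF _ N] r by simp
    have t: "0 < t" "t \<le> 1" using R N0 by (auto simp: t_def)
    have "t * N \<le> R / (N + 1) * (N + 1)"
      using R N0 by (intro mult_mono) (auto simp: t_def)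
    then have "t * N \<le> R" using N0 by simp
    then have "wiener (t * r) R (\<lambda>x. (g (p + x) - g p) \<bullet> b)"
      using wiener_mono[OF wiener_scale[OF N r _ t]] by simp
    with t r show ?thesis by (intro exI[of _ "t * r"]) simp
  qed
  then obtain s where s: "\<And>b. b \<in> Basis \<Longrightarrow> 0 < s b"
    and sR: "\<And>b. b \<in> Basis \<Longrightarrow> wiener (s b) R (\<lambda>x. (g (p + x) - g p) \<bullet> b)" by metis
  \<comment> \<open>Each component has its own radius; as \<open>Basis\<close> is finite, the
    smallest of them is positive and serves all.\<close>
  define r where "r = Min (s ` Basis)"
  have r: "0 < r" "\<And>b. b \<in> Basis \<Longrightarrow> r \<le> s b" using s by (auto simp: r_def)
  have "wiener r M (\<lambda>x. f (g p + (g (p + x) - g p)))"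
    using r by (intro wiener_compose[OF r(1) R fM] wiener_shrink[OF sR]) auto
  then show "\<exists>r>0. \<exists>N. wiener r N (\<lambda>x. f (g (p + x)))" using r by auto
qed

section \<open>Derivatives along coordinate lines and in the variables \<open>(u, w)\<close>\<close>

lemma real_analytic_on_line:
  assumes "real_analytic_on f S" "p \<in> S" "b \<in> Basis"
  shows "((\<lambda>t. f (p + (t - t0) *\<^sub>R b)) has_real_derivative pd b f p) (at t0)"
  using DERIV_shift[of "\<lambda>t. f (p + (t - t0) *\<^sub>R b)" "pd b f p" 0 t0]
    real_analytic_on_has_pd[OF assms] by simp

lemma pd_cong:
  assumes S: "open S" "p \<in> S" and fg: "\<And>q. q \<in> S \<Longrightarrow> f q = g q"
  shows "pd b f p = pd b g p"
  unfolding pd_def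
proof (rule deriv_cong_ev)
  have "((\<lambda>t. p + t *\<^sub>R b) \<longlongrightarrow> p + 0 *\<^sub>R b) (nhds (0 :: real))"
    by (intro tendsto_intros filterlim_ident)
  then have "\<forall>\<^sub>F t in nhds (0 :: real). p + t *\<^sub>R b \<in> S"
    by (rule topological_tendstoD) (use S in auto)
  then show "\<forall>\<^sub>F t in nhds 0. f (p + t *\<^sub>R b) = g (p + t *\<^sub>R b)"
    by (rule eventually_mono) (rule fg)
qed simp

lemma pd_const: "pd b (\<lambda>_. c) p = 0"
  by (simp add: pd_def)

lemma pd_0: "pd 0 f = (\<lambda>_. 0)"
  by (simp add: pd_def fun_eq_iff)

lemma D_u_eq_pd: "D_u f = pd (1, 0) f"
proof
  show "D_u f q = pd (1, 0) f q" for q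
    unfolding D_u_def pd_def by (cases q, simp, subst deriv_shift_0) (simp add: o_def)
qed

lemma D_w_eq_pd: "D_w f = pd (0, 1) f"
proof
  show "D_w f q = pd (0, 1) f q" for q
    unfolding D_w_def pd_def by (cases q, simp, subst deriv_shift_0) (simp add: o_def)
qed

lemma Basis_real_pair: "(Basis :: (real \<times> real) set) = {(1, 0), (0, 1)}"
  by (auto simp: Basis_prod_def zero_prod_def)

lemma
  assumes "real_analytic_on f S" "(u, w) \<in> S"
  shows has_derivative_D_u: "((\<lambda>t. f (t, w)) has_real_derivative D_u f (u, w)) (at u)"
    and has_derivative_D_w: "((\<lambda>t. f (u, t)) has_real_derivative D_w f (u, w)) (at w)"
  using real_analytic_on_line[OF assms, of "(1, 0)" u] real_analytic_on_line[OF assms, of "(0, 1)" w]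
  by (simp_all add: D_u_eq_pd D_w_eq_pd Basis_real_pair)

lemma real_analytic_on_D_u: "real_analytic_on f S \<Longrightarrow> real_analytic_on (D_u f) S"
  and real_analytic_on_D_w: "real_analytic_on f S \<Longrightarrow> real_analytic_on (D_w f) S"
  by (simp_all add: D_u_eq_pd D_w_eq_pd real_analytic_on_pd Basis_real_pair)

lemma D_w_D_u: "real_analytic_on f S \<Longrightarrow> q \<in> S \<Longrightarrow> D_w (D_u f) q = D_u (D_w f) q"
  unfolding D_u_eq_pd D_w_eq_pd by (rule pd_commute) (auto simp: Basis_real_pair)

section \<open>Total derivatives and prolongations\<close>

text \<open>The displacement of the base point when a jet coordinate grows by one. The value 0 for
  derivative coordinates gives a single formula for \<open>partial\<close> of a function of the base
  point.\<close>

fun dir :: "coord \<Rightarrow> point" where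
  "dir Jx = (1, 0, 0, 0)" | "dir Jy = (0, 1, 0, 0)" | "dir Jw = (0, 0, 1, 0)" | "dir JE = (0, 0, 0, 1)"
| "dir _ = 0"

lemma Basis_point: "(Basis :: point set) = {dir Jx, dir Jy, dir Jw, dir JE}"
  by (auto simp: Basis_prod_def zero_prod_def)

lemma dir_cases: "dir c \<in> Basis \<or> dir c = 0"
  by (cases c) (auto simp: Basis_point)

lemma dir_Basis: "dir Jx \<in> Basis" "dir Jy \<in> Basis" "dir Jw \<in> Basis" "dir JE \<in> Basis"
  by (simp_all add: Basis_point)

abbreviation Dx :: "(point \<Rightarrow> real) \<Rightarrow> point \<Rightarrow> real" where "Dx \<equiv> pd (dir Jx)"
abbreviation Dy :: "(point \<Rightarrow> real) \<Rightarrow> point \<Rightarrow> real" where "Dy \<equiv> pd (dir Jy)"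
abbreviation Dw :: "(point \<Rightarrow> real) \<Rightarrow> point \<Rightarrow> real" where "Dw \<equiv> pd (dir Jw)"
abbreviation DE :: "(point \<Rightarrow> real) \<Rightarrow> point \<Rightarrow> real" where "DE \<equiv> pd (dir JE)"

lemma base_upd: "base (j(c := t)) = base j + (t - j c) *\<^sub>R dir c"
  by (cases c) (simp_all add: base_def zero_prod_def)

lemma has_derivative_base:
  assumes "real_analytic_on f D" "base j \<in> D"
  shows "((\<lambda>t. f (base (j(c := t)))) has_real_derivative pd (dir c) f (base j)) (at (j c))"
proof (cases "dir c = 0")
  case False
  then show ?thesis
    unfolding base_upd using dir_cases[of c] by (intro real_analytic_on_line[OF assms]) auto
qed (simp add: base_upd pd_0)

lemma has_derivative_coord:
  "((\<lambda>t. (j(c := t)) a) has_real_derivative (if c = a then 1 else 0)) (at t)"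
  by (cases "c = a") auto

lemma real_analytic_on_dir: "real_analytic_on f D \<Longrightarrow> real_analytic_on (pd (dir c) f) D"
  using dir_cases[of c] real_analytic_on_pd[of f D "dir c"]
  by (auto simp: pd_0 real_analytic_on_const)

text \<open>First total derivatives of functions of the base point have this affine form, so the
  rule is what evaluates the second total derivatives.\<close>

lemma partial_affine:
  assumes "real_analytic_on f D" "real_analytic_on g D" "real_analytic_on h D" "base j \<in> D"
  shows "partial c (\<lambda>j. f (base j) + j a * g (base j) + j b * h (base j)) j =
           pd (dir c) f (base j) + j a * pd (dir c) g (base j) + j b * pd (dir c) h (base j)
           + (if c = a then g (base j) else 0) + (if c = b then h (base j) else 0)"
  unfolding partial_def
  by (rule DERIV_imp_deriv)
    (rule derivative_eq_intros has_derivative_base[OF _ assms(4)] has_derivative_coord assms refl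
      | simp)+

lemma partial_base: "partial c (\<lambda>j. f (base j)) j = pd (dir c) f (base j)"
  unfolding partial_def pd_def base_upd
  by (subst deriv_shift_0) (simp add: o_def)

lemma partial_const: "partial c (\<lambda>_. a) j = 0"
  by (simp add: partial_def)

lemma
  shows total_x_base: "total_x (\<lambda>j. f (base j)) =
      (\<lambda>j. Dx f (base j) + j Jwx * Dw f (base j) + j JEx * DE f (base j))"
    and total_y_base: "total_y (\<lambda>j. f (base j)) =
      (\<lambda>j. Dy f (base j) + j Jwy * Dw f (base j) + j JEy * DE f (base j))"
  by (simp_all add: fun_eq_iff total_x_def total_y_def partial_base pd_0 del: dir.simps(1-4))

text \<open>The product rule for
  \<open>f\<^sub>x + w\<^sub>x f\<^sub>w + E\<^sub>x f\<^sub>E\<close>, whose jet variables have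
  total x-derivatives \<open>w\<^sub>x\<^sub>x\<close> and \<open>E\<^sub>x\<^sub>x\<close>, and the
  same in y.\<close>

lemma
  assumes "real_analytic_on f D" "base j \<in> D"
  shows total_x_total_x_base: "total_x (total_x (\<lambda>j. f (base j))) j =
      total_x (\<lambda>j. Dx f (base j)) j + j Jwx * total_x (\<lambda>j. Dw f (base j)) j
      + j JEx * total_x (\<lambda>j. DE f (base j)) j + j Jwxx * Dw f (base j) + j JExx * DE f (base j)"
    and total_y_total_y_base: "total_y (total_y (\<lambda>j. f (base j))) j =
      total_y (\<lambda>j. Dy f (base j)) j + j Jwy * total_y (\<lambda>j. Dw f (base j)) j
      + j JEy * total_y (\<lambda>j. DE f (base j)) j + j Jwyy * Dw f (base j) + j JEyy * DE f (base j)"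
proof -
  note an = assms(1)[THEN real_analytic_on_dir]
  note aff = partial_affine[OF an an an assms(2)]
  show "total_x (total_x (\<lambda>j. f (base j))) j =
      total_x (\<lambda>j. Dx f (base j)) j + j Jwx * total_x (\<lambda>j. Dw f (base j)) j
      + j JEx * total_x (\<lambda>j. DE f (base j)) j + j Jwxx * Dw f (base j) + j JExx * DE f (base j)"
    unfolding total_x_base
    unfolding total_x_def aff by (simp add: pd_0 algebra_simps del: dir.simps(1-4))
  show "total_y (total_y (\<lambda>j. f (base j))) j =
      total_y (\<lambda>j. Dy f (base j)) j + j Jwy * total_y (\<lambda>j. Dw f (base j)) j
      + j JEy * total_y (\<lambda>j. DE f (base j)) j + j Jwyy * Dw f (base j) + j JEyy * DE f (base j)"
    unfolding total_y_base
    unfolding total_y_def aff by (simp add: pd_0 algebra_simps del: dir.simps(1-4))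
qed

section \<open>Prolongations of fields with constant \<xi>\<close>

definition vf :: "real \<Rightarrow> (point \<Rightarrow> real) \<Rightarrow> (point \<Rightarrow> real) \<Rightarrow> vfield" where
  "vf k f g = \<lparr>xi = \<lambda>_. k, eta = \<lambda>_. 1, phi = f, psi = g\<rparr>"

lemma vf_sel [simp]:
  "xi (vf k f g) = (\<lambda>_. k)" "eta (vf k f g) = (\<lambda>_. 1)" "phi (vf k f g) = f" "psi (vf k f g) = g"
  by (simp_all add: vf_def)

text \<open>The correction terms of the prolongation formula contain total derivatives of \<xi> and
  \<eta>. Both are constant here, so prolongation coefficients are iterated total
  derivatives.\<close>

lemma prol_vf:
  "prol_x (vf k f g) a b F = total_x F" "prol_y (vf k f g) a b F = total_y F"
  by (simp_all add: fun_eq_iff prol_x_def prol_y_def o_def total_x_def[of "\<lambda>_. _"]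
      total_y_def[of "\<lambda>_. _"] partial_const)

lemma partial_F_eq:
  "partial c F_eq j = (case c of Jwx \<Rightarrow> j JEx | Jwy \<Rightarrow> j JEy | JEx \<Rightarrow> j Jwx | JEy \<Rightarrow> j Jwy
     | JE \<Rightarrow> j Jwxx + j Jwyy | Jwxx \<Rightarrow> j JE | Jwyy \<Rightarrow> j JE | _ \<Rightarrow> 0)"
proof -
  have "((\<lambda>t. F_eq (j(c := t))) has_real_derivative (case c of Jwx \<Rightarrow> j JEx | Jwy \<Rightarrow> j JEy
     | JEx \<Rightarrow> j Jwx | JEy \<Rightarrow> j Jwy | JE \<Rightarrow> j Jwxx + j Jwyy | Jwxx \<Rightarrow> j JE | Jwyy \<Rightarrow> j JE | _ \<Rightarrow> 0)) (at (j c))"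
    unfolding F_eq_def
    by (rule derivative_eq_intros has_derivative_coord refl)+ (cases c; simp)
  then show ?thesis unfolding partial_def by (rule DERIV_imp_deriv)
qed

lemma pr2_F_eq:
  assumes "real_analytic_on f D" "base j \<in> D"
  shows "pr 2 (vf k f g) F_eq j =
     total_x (\<lambda>j. f (base j)) j * j JEx + total_y (\<lambda>j. f (base j)) j * j JEy
     + total_x (\<lambda>j. g (base j)) j * j Jwx + total_y (\<lambda>j. g (base j)) j * j Jwy
     + g (base j) * (j Jwxx + j Jwyy)
     + j JE * (total_x (total_x (\<lambda>j. f (base j))) j + total_y (total_y (\<lambda>j. f (base j))) j)"
proof -
  have "jet_order c \<le> 2" for c by (cases c) simp_all
  then have "{c. jet_order c \<le> 2} = UNIV" by blast
  then show ?thesis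
    by (simp add: pr_def UNIV_coord partial_F_eq prol_vf o_def algebra_simps)
qed

lemma inv_surf_vf:
  "inv_surf1 (vf k f g) = (\<lambda>j. k * j Jwx + j Jwy - f (base j))"
  "inv_surf2 (vf k f g) = (\<lambda>j. k * j JEx + j JEy - g (base j))"
  by (simp_all add: fun_eq_iff inv_surf1_def inv_surf2_def)

lemma partial_inv_surf:
  assumes "real_analytic_on f D" "base j \<in> D"
  shows "partial c (\<lambda>j. k * j a + j b - f (base j)) j =
    (if c = a then k else 0) + (if c = b then 1 else 0) - pd (dir c) f (base j)"
  unfolding partial_def
  by (rule DERIV_imp_deriv)
    (rule derivative_eq_intros has_derivative_base[OF _ assms(2)] has_derivative_coord assms refl
      | simp)+

lemma total_inv_surf:
  assumes f: "real_analytic_on f D" "base j \<in> D"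
  shows "total_x (\<lambda>j. k * j Jwx + j Jwy - f (base j)) j
           = k * j Jwxx + j Jwxy - total_x (\<lambda>j. f (base j)) j"
    and "total_y (\<lambda>j. k * j Jwx + j Jwy - f (base j)) j
           = k * j Jwxy + j Jwyy - total_y (\<lambda>j. f (base j)) j"
    and "total_x (\<lambda>j. k * j JEx + j JEy - f (base j)) j
           = k * j JExx + j JExy - total_x (\<lambda>j. f (base j)) j"
    and "total_y (\<lambda>j. k * j JEx + j JEy - f (base j)) j
           = k * j JExy + j JEyy - total_y (\<lambda>j. f (base j)) j"
  unfolding total_x_def total_y_def partial_inv_surf[OF f] partial_base
  by (simp_all add: pd_0 algebra_simps del: dir.simps(1-4))

text \<open>Only because \<open>\<xi>\<close> and \<open>\<eta>\<close> are constant do the differentiated constraints play no role here.\<close>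

lemma pr1_inv_surf:
  assumes f: "real_analytic_on f D" and g: "real_analytic_on g D" and j: "base j \<in> D"
    and "inv_surf1 (vf k f g) j = 0" "inv_surf2 (vf k f g) j = 0"
  shows "pr 1 (vf k f g) (inv_surf1 (vf k f g)) j = 0"
    and "pr 1 (vf k f g) (inv_surf2 (vf k f g)) j = 0"
proof -
  \<comment> \<open>On the invariant surfaces the terms \<open>f f\<^sub>w\<close> and
    \<open>g f\<^sub>E\<close> become those of k times the total x-derivative plus the total
    y-derivative of \<open>f\<close>, so everything cancels; likewise for the derivatives of
    \<open>g\<close>.\<close>
  have fj: "f (base j) = k * j Jwx + j Jwy" and gj: "g (base j) = k * j JEx + j JEy"
    using assms(4,5) by (simp_all add: inv_surf_vf)
  have "c \<in> {Jx, Jy, Jw, JE, Jwx, Jwy, JEx, JEy} \<longleftrightarrow> jet_order c \<le> 1" for c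
    by (cases c) auto
  then have S: "{c. jet_order c \<le> 1} = {Jx, Jy, Jw, JE, Jwx, Jwy, JEx, JEy}" by blast
  show "pr 1 (vf k f g) (inv_surf1 (vf k f g)) j = 0"
    unfolding pr_def S inv_surf_vf partial_inv_surf[OF f j]
    by (simp add: prol_vf o_def total_x_base total_y_base fj gj pd_0 algebra_simps del: dir.simps(1-4))
  show "pr 1 (vf k f g) (inv_surf2 (vf k f g)) j = 0"
    unfolding pr_def S inv_surf_vf partial_inv_surf[OF g j]
    by (simp add: prol_vf o_def total_x_base total_y_base fj gj pd_0 algebra_simps del: dir.simps(1-4))
qed

section \<open>Invariance under changes of the coefficients outside \<open>D\<close>\<close>

lemma partial_cong:
  assumes "open D" "base j \<in> D" and fg: "\<And>i. base i \<in> D \<Longrightarrow> f i = g i"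
  shows "partial c f j = partial c g j"
  unfolding partial_def
proof (rule deriv_cong_ev)
  have "((\<lambda>t. base j + (t - j c) *\<^sub>R dir c) \<longlongrightarrow> base j + (j c - j c) *\<^sub>R dir c) (nhds (j c))"
    by (intro tendsto_intros filterlim_ident)
  then have "\<forall>\<^sub>F t in nhds (j c). base (j(c := t)) \<in> D"
    unfolding base_upd by (rule topological_tendstoD) (use assms in auto)
  then show "\<forall>\<^sub>F t in nhds (j c). f (j(c := t)) = g (j(c := t))"
    by (rule eventually_mono) (rule fg)
qed simp

lemma total_cong:
  assumes "open D" "base j \<in> D" "\<And>i. base i \<in> D \<Longrightarrow> f i = g i"
  shows "total_x f j = total_x g j" "total_y f j = total_y g j"
  unfolding total_x_def total_y_def using partial_cong[OF assms] by simp_all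

lemma prol_cong:
  assumes D: "open D" "base j \<in> D" and fg: "\<And>i. base i \<in> D \<Longrightarrow> f i = g i"
    and U: "\<And>p. p \<in> D \<Longrightarrow> xi U p = xi W p" "\<And>p. p \<in> D \<Longrightarrow> eta U p = eta W p"
  shows "prol_x U a b f j = prol_x W a b g j" "prol_y U a b f j = prol_y W a b g j"
proof -
  have "total_x (xi U \<circ> base) j = total_x (xi W \<circ> base) j"
    "total_y (xi U \<circ> base) j = total_y (xi W \<circ> base) j"
    "total_x (eta U \<circ> base) j = total_x (eta W \<circ> base) j"
    "total_y (eta U \<circ> base) j = total_y (eta W \<circ> base) j"
    by (rule total_cong[OF D]; simp add: U)+
  with total_cong[OF D fg]
  show "prol_x U a b f j = prol_x W a b g j" "prol_y U a b f j = prol_y W a b g j"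
    unfolding prol_x_def prol_y_def by simp_all
qed

lemma prol_coeff_cong:
  assumes D: "open D" "base j \<in> D"
    and U: "\<And>p. p \<in> D \<Longrightarrow> xi U p = xi W p" "\<And>p. p \<in> D \<Longrightarrow> eta U p = eta W p"
      "\<And>p. p \<in> D \<Longrightarrow> phi U p = phi W p" "\<And>p. p \<in> D \<Longrightarrow> psi U p = psi W p"
  shows "prol_coeff U c j = prol_coeff W c j"
proof -
  show ?thesis using D(2)
    by (cases c) (auto simp: U intro!: prol_cong[OF D(1) _ _ U(1,2)])
qed

text \<open>All derivatives are local and taken over points of the open set \<open>D\<close>. This
  permits passing between fields written with \<open>vf\<close> and fields that agree with them on
  \<open>D\<close>.\<close>

lemma nonclassical_generator_cong:
  assumes "nonclassical_generator D U"
    and U: "\<And>p. p \<in> D \<Longrightarrow> xi U p = xi W p" "\<And>p. p \<in> D \<Longrightarrow> eta U p = eta W p"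
      "\<And>p. p \<in> D \<Longrightarrow> phi U p = phi W p" "\<And>p. p \<in> D \<Longrightarrow> psi U p = psi W p"
  shows "nonclassical_generator D W"
proof -
  have D: "open D" using assms(1) by (simp add: nonclassical_generator_def)
  have inv: "inv_surf1 U j = inv_surf1 W j" "inv_surf2 U j = inv_surf2 W j" if "base j \<in> D" for j
    using that by (simp_all add: inv_surf1_def inv_surf2_def U)
  have tot: "total_x (inv_surf1 U) j = total_x (inv_surf1 W) j"
    "total_y (inv_surf1 U) j = total_y (inv_surf1 W) j"
    "total_x (inv_surf2 U) j = total_x (inv_surf2 W) j"
    "total_y (inv_surf2 U) j = total_y (inv_surf2 W) j" if "base j \<in> D" for j
    using that by (auto intro!: total_cong[OF D] inv)
  have pr: "pr n U f j = pr n W g j" if "base j \<in> D" "\<And>i. base i \<in> D \<Longrightarrow> f i = g i" for n f g j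
    unfolding pr_def using prol_coeff_cong[OF D that(1) U] partial_cong[OF D that] by simp
  have pr': "pr 2 U F_eq j = pr 2 W F_eq j" "pr 1 U (inv_surf1 U) j = pr 1 W (inv_surf1 W) j"
    "pr 1 U (inv_surf2 U) j = pr 1 W (inv_surf2 W) j" if "base j \<in> D" for j
    using that by (auto intro!: pr inv)
  have "real_analytic_on (xi U) D" "real_analytic_on (phi U) D" "real_analytic_on (psi U) D"
    using assms(1) by (simp_all add: nonclassical_generator_def)
  note cong = this[THEN real_analytic_on_cong[OF _ D]]
  have an: "real_analytic_on (xi W) D" "real_analytic_on (phi W) D" "real_analytic_on (psi W) D"
    using cong(1)[OF U(1)] cong(2)[OF U(3)] cong(3)[OF U(4)] by blast+
  show ?thesis
    using assms(1) an U(2) unfolding nonclassical_generator_def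
    by (simp add: inv tot pr' del: One_nat_def cong: conj_cong imp_cong)
qed

section \<open>Generators with constant \<open>\<xi>\<close>\<close>

text \<open>Makes the second-order part of the jet solve the differentiated constraints together
  with the equation; \<open>w\<^sub>x\<close> and \<open>E\<^sub>x\<close> stay free.\<close>

lemma constraint_jet_exists:
  assumes f: "real_analytic_on f D" and g: "real_analytic_on g D"
    and p: "(x, y, w, E) \<in> D" and E: "E \<noteq> 0"
  obtains j where "base j = (x, y, w, E)" "j Jwx = a" "j JEx = b" "F_eq j = 0"
    "inv_surf1 (vf k f g) j = 0" "inv_surf2 (vf k f g) j = 0"
    "total_x (inv_surf1 (vf k f g)) j = 0" "total_y (inv_surf1 (vf k f g)) j = 0"
    "total_x (inv_surf2 (vf k f g)) j = 0" "total_y (inv_surf2 (vf k f g)) j = 0"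
proof -
  let ?p = "(x, y, w, E)"
  define wy where "wy = f ?p - k * a"
  define ey where "ey = g ?p - k * b"
  define fX where "fX = Dx f ?p + a * Dw f ?p + b * DE f ?p"
  define fY where "fY = Dy f ?p + wy * Dw f ?p + ey * DE f ?p"
  define gX where "gX = Dx g ?p + a * Dw g ?p + b * DE g ?p"
  define gY where "gY = Dy g ?p + wy * Dw g ?p + ey * DE g ?p"
  \<comment> \<open>The differentiated constraints express \<open>w\<^sub>x\<^sub>y\<close> and
    \<open>w\<^sub>y\<^sub>y\<close> through \<open>w\<^sub>x\<^sub>x\<close>, giving
    \<open>w\<^sub>x\<^sub>x + w\<^sub>y\<^sub>y = (k\<^sup>2 + 1) w\<^sub>x\<^sub>x + fY - k
    fX\<close>. The equation then determines \<open>w\<^sub>x\<^sub>x\<close>.\<close>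
  define wxx where "wxx = ((- 1 - a * b - wy * ey) / E - (fY - k * fX)) / (k\<^sup>2 + 1)"
  \<comment> \<open>The value of \<open>E\<^sub>x\<^sub>x\<close> is free and taken to be 0; the
    other second derivatives of E follow from it.\<close>
  define j where "j c = (case c of Jx \<Rightarrow> x | Jy \<Rightarrow> y | Jw \<Rightarrow> w | JE \<Rightarrow> E
     | Jwx \<Rightarrow> a | Jwy \<Rightarrow> wy | JEx \<Rightarrow> b | JEy \<Rightarrow> ey
     | Jwxx \<Rightarrow> wxx | Jwxy \<Rightarrow> fX - k * wxx | Jwyy \<Rightarrow> fY - k * (fX - k * wxx)
     | JExx \<Rightarrow> 0 | JExy \<Rightarrow> gX | JEyy \<Rightarrow> gY - k * gX)" for c
  have base: "base j = ?p" by (simp add: base_def j_def)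
  then have D: "base j \<in> D" using p by simp
  have "k\<^sup>2 + 1 \<noteq> 0" by (metis add_nonneg_pos less_irrefl zero_le_power2 zero_less_one)
  then have "wxx * (k\<^sup>2 + 1) = (- 1 - a * b - wy * ey) / E - (fY - k * fX)"
    by (simp add: wxx_def)
  then have "E * (wxx * (k\<^sup>2 + 1) + (fY - k * fX)) = - 1 - a * b - wy * ey"
    using E by simp
  then have "F_eq j = 0" by (simp add: F_eq_def j_def algebra_simps power2_eq_square)
  moreover have "inv_surf1 (vf k f g) j = 0" "inv_surf2 (vf k f g) j = 0"
    unfolding inv_surf_vf base by (simp_all add: j_def wy_def ey_def)
  moreover have "total_x (inv_surf1 (vf k f g)) j = 0" "total_y (inv_surf1 (vf k f g)) j = 0"
    "total_x (inv_surf2 (vf k f g)) j = 0" "total_y (inv_surf2 (vf k f g)) j = 0"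
    unfolding inv_surf_vf total_inv_surf[OF f D] total_inv_surf[OF g D] total_x_base total_y_base base
    by (simp_all add: j_def fX_def fY_def gX_def gY_def del: dir.simps(1-4))
  moreover have "j Jwx = a" "j JEx = b" by (simp_all add: j_def)
  ultimately show ?thesis using that base by blast
qed

section \<open>Coefficients \<phi> that do not depend on E\<close>

text \<open>Demanded on the whole space and not just on a domain, so that values and derivatives at
  different E can be compared freely.\<close>

definition E_indep :: "(point \<Rightarrow> real) \<Rightarrow> bool" where
  "E_indep f \<longleftrightarrow> (\<forall>x y w E F. f (x, y, w, E) = f (x, y, w, F))"

lemma E_indepD: "E_indep f \<Longrightarrow> f (x, y, w, E) = f (x, y, w, F)"
  unfolding E_indep_def by blast

lemma E_indep_pd:
  assumes "E_indep f"
  shows "E_indep (pd b f)"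
proof -
  obtain b1 b2 b3 b4 where b: "b = (b1, b2, b3, b4)" by (cases b)
  have "f ((x, y, w, E) + t *\<^sub>R b) = f ((x, y, w, F) + t *\<^sub>R b)" for x y w E F t
    unfolding b by (simp, rule E_indepD[OF assms])
  then show ?thesis
    unfolding E_indep_def pd_def by (intro allI arg_cong[where f = "\<lambda>h. deriv h 0"] ext)
qed

lemma DE_E_indep: "E_indep f \<Longrightarrow> DE f = (\<lambda>_. 0)"
proof
  fix p assume "E_indep f"
  then have "(\<lambda>t. f (p + t *\<^sub>R dir JE)) = (\<lambda>t. f p)"
    by (cases p) (auto simp: fun_eq_iff intro: E_indepD)
  then show "DE f p = 0" by (simp add: pd_def)
qed

lemma total_const: "total_x (\<lambda>_. a) j = 0" "total_y (\<lambda>_. a) j = 0"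
  by (simp_all add: total_x_def total_y_def partial_const)

text \<open>Once \<open>f\<^sub>E = 0\<close>, second-order jet coordinates enter only through
  \<open>w\<^sub>x\<^sub>x + w\<^sub>y\<^sub>y\<close>, which the equation determines from
  lower-order data.\<close>

lemma pr2_F_eq_E_indep:
  assumes f: "real_analytic_on f D" "E_indep f" and j: "base j \<in> D"
  shows "pr 2 (vf k f g) F_eq j =
    (let p = base j; wx = j Jwx; wy = j Jwy; ex = j JEx; ey = j JEy in
     (Dx f p + wx * Dw f p) * ex + (Dy f p + wy * Dw f p) * ey
     + (Dx g p + wx * Dw g p + ex * DE g p) * wx + (Dy g p + wy * Dw g p + ey * DE g p) * wy
     + g p * (j Jwxx + j Jwyy)
     + j JE * (Dx (Dx f) p + 2 * wx * Dw (Dx f) p + Dy (Dy f) p + 2 * wy * Dw (Dy f) p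
        + (wx\<^sup>2 + wy\<^sup>2) * Dw (Dw f) p + (j Jwxx + j Jwyy) * Dw f p))"
proof -
  have "Dx (Dw f) (base j) = Dw (Dx f) (base j)" "Dy (Dw f) (base j) = Dw (Dy f) (base j)"
    by (rule pd_commute[OF f(1) j]; rule dir_Basis)+
  then show ?thesis
    unfolding pr2_F_eq[OF f(1) j] total_x_total_x_base[OF f(1) j] total_y_total_y_base[OF f(1) j]
    using DE_E_indep[OF f(2)] DE_E_indep[OF E_indep_pd[OF f(2)]]
    by (simp add: total_x_base total_y_base Let_def pd_const total_const power2_eq_square algebra_simps
        del: dir.simps(1-4))
qed

lemma pd_cmult:
  assumes "real_analytic_on f S" "p \<in> S" "b \<in> Basis"
  shows "pd b (\<lambda>q. c * f q) p = c * pd b f p"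
  unfolding pd_def[of b "\<lambda>q. c * f q"]
  by (rule DERIV_imp_deriv, rule DERIV_cmult, rule real_analytic_on_has_pd[OF assms])

lemma pd_E_mult:
  fixes f :: "point \<Rightarrow> real"
  assumes "real_analytic_on f S" "p \<in> S" "b \<in> Basis"
  shows "pd b (\<lambda>q. - snd (snd (snd q)) * f q) p
           = - snd (snd (snd b)) * f p - snd (snd (snd p)) * pd b f p"
  unfolding pd_def[of b "\<lambda>q. - snd (snd (snd q)) * f q"]
  by (rule DERIV_imp_deriv)
    (auto intro!: derivative_eq_intros real_analytic_on_has_pd[OF assms] simp: algebra_simps)

section \<open>Sufficient conditions for a generator\<close>

text \<open>The choice \<psi> = -E \<open>\<phi>\<^sub>w\<close> cancels the coefficient of
  \<open>w\<^sub>x\<^sub>x + w\<^sub>y\<^sub>y\<close>. With \<phi> varying in x and y as a function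
  of kx + y, what is left is E times the defect in \<open>fyy\<close>.\<close>

lemma generator_sufficient:
  assumes D: "open D" "\<And>p. p \<in> D \<Longrightarrow> snd (snd (snd p)) \<noteq> 0"
    and f: "real_analytic_on f D" "E_indep f"
    and fx: "\<And>p. p \<in> D \<Longrightarrow> Dx f p = k * Dy f p"
    and fyy: "\<And>p. p \<in> D \<Longrightarrow> (k\<^sup>2 + 1) * Dy (Dy f) p = Dw f p * Dy f p - f p * Dw (Dy f) p"
  shows "nonclassical_generator D (vf k f (\<lambda>p. - snd (snd (snd p)) * Dw f p))"
proof -
  define g where "g p = - snd (snd (snd p)) * Dw f p" for p
  have snd3: "snd (snd (snd p)) = p \<bullet> dir JE" for p :: point by (cases p) simp
  have "real_analytic_on (\<lambda>p. (- 1 * (p \<bullet> dir JE)) * Dw f p) D"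
    by (intro real_analytic_on_mult real_analytic_on_const real_analytic_on_inner
        real_analytic_on_dir f dir_Basis)
  then have g: "real_analytic_on g D" by (simp add: g_def[abs_def] snd3)
  have "pr 2 (vf k f g) F_eq j = 0"
    if j: "base j \<in> D" and s1: "inv_surf1 (vf k f g) j = 0" and s2: "inv_surf2 (vf k f g) j = 0" for j
  proof -
    let ?p = "base j"
    have E: "snd (snd (snd ?p)) = j JE" by (simp add: base_def)
    have w: "f ?p = k * j Jwx + j Jwy" using s1 by (simp add: inv_surf_vf)
    have ey: "j JEy = - j JE * Dw f ?p - k * j JEx" using s2 by (simp add: inv_surf_vf g_def E)
    \<comment> \<open>The relation \<open>fx\<close> holds on an open set and may therefore be
      differentiated.\<close>
    have c: "pd b (Dx f) ?p = k * pd b (Dy f) ?p" if "b \<in> Basis" for b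
      by (rule trans[OF pd_cong[OF D(1) j] pd_cmult[OF real_analytic_on_dir[OF f(1)] j that]]) (rule fx)
    have com: "pd b (Dw f) ?p = Dw (pd b f) ?p" "Dx (Dy f) ?p = Dy (Dx f) ?p" if "b \<in> Basis" for b
      by (rule pd_commute[OF f(1) j]; (rule dir_Basis that))+
    note Eg = pd_E_mult[OF real_analytic_on_dir[OF f(1), of Jw] j]
    have fxx: "Dx (Dx f) ?p = k\<^sup>2 * Dy (Dy f) ?p" and fxw: "Dw (Dx f) ?p = k * Dw (Dy f) ?p"
      using c[OF dir_Basis(1)] c[OF dir_Basis(2)] c[OF dir_Basis(3)] com(2)[OF dir_Basis(1)]
      by (simp_all add: power2_eq_square del: dir.simps(1-4))
    have gd: "Dx g ?p = - j JE * (k * Dw (Dy f) ?p)" "Dy g ?p = - j JE * Dw (Dy f) ?p"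
      "Dw g ?p = - j JE * Dw (Dw f) ?p" "DE g ?p = - Dw f ?p"
      unfolding g_def[abs_def] Eg[OF dir_Basis(1)] Eg[OF dir_Basis(2)] Eg[OF dir_Basis(3)] Eg[OF dir_Basis(4)] E
      using com(1)[OF dir_Basis(1)] com(1)[OF dir_Basis(2)] com(1)[OF dir_Basis(4)] fxw
        DE_E_indep[OF E_indep_pd[OF f(2)]]
      by simp_all
    have yy: "k\<^sup>2 * Dy (Dy f) ?p + Dy (Dy f) ?p = Dw f ?p * Dy f ?p - f ?p * Dw (Dy f) ?p"
      using fyy[OF j] by (simp add: algebra_simps del: dir.simps(1-4))
    have "pr 2 (vf k f g) F_eq j = j JE * (k\<^sup>2 * Dy (Dy f) ?p + Dy (Dy f) ?p
             - (Dw f ?p * Dy f ?p - f ?p * Dw (Dy f) ?p))"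
      unfolding pr2_F_eq_E_indep[OF f j] Let_def fx[OF j] fxx fxw gd ey w g_def E
      by (simp add: algebra_simps power2_eq_square del: dir.simps(1-4))
    then show ?thesis using yy by simp
  qed
  moreover have "\<forall>(x, y, w, E)\<in>D. E \<noteq> 0" using D(2) by fastforce
  ultimately have "nonclassical_generator D (vf k f g)"
    using D(1) f(1) g pr1_inv_surf[OF f(1) g]
    by (simp add: nonclassical_generator_def real_analytic_on_const)
  then show ?thesis by (simp add: g_def[abs_def])
qed

section \<open>Determination of \<psi> from \<xi> and \<phi>\<close>

text \<open>Eliminating \<open>w\<^sub>x\<^sub>x + w\<^sub>y\<^sub>y\<close> by the equation leaves
  a relation that holds for all values of \<open>w\<^sub>x\<close> and \<open>E\<^sub>x\<close>,
  since every such pair extends to an admissible jet.\<close>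

lemma generator_residual:
  assumes gen: "nonclassical_generator D (vf k f g)" and f: "E_indep f"
    and p: "p = (x, y, w, E)" "p \<in> D" and wy: "wy = f p - k * wx" and ey: "ey = g p - k * ex"
  shows "(Dx f p + wx * Dw f p) * ex + (Dy f p + wy * Dw f p) * ey
     + (Dx g p + wx * Dw g p + ex * DE g p) * wx + (Dy g p + wy * Dw g p + ey * DE g p) * wy
     + E * (Dx (Dx f) p + 2 * wx * Dw (Dx f) p + Dy (Dy f) p + 2 * wy * Dw (Dy f) p
            + (wx\<^sup>2 + wy\<^sup>2) * Dw (Dw f) p)
     = (g p / E + Dw f p) * (1 + wx * ex + wy * ey)"
proof -
  have an: "real_analytic_on f D" "real_analytic_on g D" and E: "E \<noteq> 0"
    using gen p by (auto simp: nonclassical_generator_def)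
  obtain j where j: "base j = p" "j Jwx = wx" "j JEx = ex" "F_eq j = 0"
    "inv_surf1 (vf k f g) j = 0" "inv_surf2 (vf k f g) j = 0"
    "total_x (inv_surf1 (vf k f g)) j = 0" "total_y (inv_surf1 (vf k f g)) j = 0"
    "total_x (inv_surf2 (vf k f g)) j = 0" "total_y (inv_surf2 (vf k f g)) j = 0"
    using constraint_jet_exists[OF an p(2)[unfolded p(1)] E] p(1) by metis
  have D: "base j \<in> D" using j p by simp
  have pr: "pr 2 (vf k f g) F_eq j = 0"
    using gen j p unfolding nonclassical_generator_def by blast
  have s: "j Jwy = wy" "j JEy = ey" using j(5,6) by (simp_all add: inv_surf_vf j wy ey)
  have jE: "j JE = E" using j(1) p(1) by (simp add: base_def)
  define L where "L = j Jwxx + j Jwyy"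
  have "E * L = - (1 + wx * ex + wy * ey)" using j(4) by (simp add: F_eq_def s j(2,3) jE L_def)
  then have L: "L = - (1 + wx * ex + wy * ey) / E" using E by (simp add: field_simps)
  have gE: "g p * L + E * (L * Dw f p) = - (g p / E + Dw f p) * (1 + wx * ex + wy * ey)"
    unfolding L using E by (simp add: field_simps del: dir.simps(1-4))
  show ?thesis
    using pr gE unfolding pr2_F_eq_E_indep[OF an(1) f D] Let_def j(1-3) s jE L_def[symmetric]
    by (simp add: algebra_simps del: dir.simps(1-4))
qed

lemma generator_psi_linear:
  assumes gen: "nonclassical_generator D (vf k f g)" and f: "E_indep f"
    and p: "p = (x, y, w, E)" "p \<in> D"
  shows "DE g p = g p / E"
proof -
  define m where "m = g p / E"
  \<comment> \<open>The residual as a polynomial in \<open>a = w\<^sub>x\<close> and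
    \<open>b = E\<^sub>x\<close>. Its only term containing both variables is a multiple of
    \<open>a * b\<close>, so the mixed second difference over {0,1} x {0,1} isolates that
    coefficient.\<close>
  define R where "R a b = (Dx f p + a * Dw f p) * b + (Dy f p + (f p - k * a) * Dw f p) * (g p - k * b)
     + (Dx g p + a * Dw g p + b * DE g p) * a
     + (Dy g p + (f p - k * a) * Dw g p + (g p - k * b) * DE g p) * (f p - k * a)
     + E * (Dx (Dx f) p + 2 * a * Dw (Dx f) p + Dy (Dy f) p + 2 * (f p - k * a) * Dw (Dy f) p
            + (a\<^sup>2 + (f p - k * a)\<^sup>2) * Dw (Dw f) p)
     - (m + Dw f p) * (1 + a * b + (f p - k * a) * (g p - k * b))" for a b
  have "R a b = 0" for a b
    using generator_residual[OF gen f p refl refl, of a b]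
    by (simp add: R_def m_def del: dir.simps(1-4))
  moreover have "R 1 1 - R 1 0 - R 0 1 + R 0 0 = (k\<^sup>2 + 1) * (DE g p - m)"
    by (simp add: R_def algebra_simps power2_eq_square del: dir.simps(1-4))
  ultimately have "(k\<^sup>2 + 1) * (DE g p - g p / E) = 0" by (simp add: m_def)
  moreover have "k\<^sup>2 + 1 \<noteq> 0" by (metis add_nonneg_pos less_irrefl zero_le_power2 zero_less_one)
  ultimately show ?thesis by simp
qed

text \<open>The constant term of the residual is compared at two values of E: \<open>E * S\<close>
  and \<open>F * S\<close> are the same number with the same \<open>S\<close>, so
  \<open>S = 0\<close>.\<close>

lemma generator_psi:
  assumes gen: "nonclassical_generator D (vf k f g)" and f: "E_indep f"
    and p: "(x, y, w, E) \<in> D"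
  shows "g (x, y, w, E) = - E * Dw f (x, y, w, E)"
proof -
  \<comment> \<open>The coordinate x stays fixed: for \<open>w\<^sub>x = 0\<close> the x-derivative
    of \<psi> drops out of the residual.\<close>
  let ?p = "\<lambda>s v F. (x, s, v, F) :: point"
  have D: "open D" and g: "real_analytic_on g D" and nz: "\<And>x y w E. (x, y, w, E) \<in> D \<Longrightarrow> E \<noteq> 0"
    using gen by (auto simp: nonclassical_generator_def)
  note E = nz[OF p]
  \<comment> \<open>In a product neighbourhood y, w and E can vary independently, so that the
    scaling of \<psi> in E holds for all nearby y and w and can be differentiated in them.\<close>
  obtain X Y W I where box: "open X" "open Y" "open W" "open I" "x \<in> X" "y \<in> Y" "w \<in> W" "E \<in> I"
    "X \<times> Y \<times> W \<times> I \<subseteq> D"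
  proof -
    obtain X T where T: "open X" "open T" "x \<in> X" "(y, w, E) \<in> T" "X \<times> T \<subseteq> D"
      using open_prod_elim[OF D p] by (metis mem_Sigma_iff)
    obtain Y T' where T': "open Y" "open T'" "y \<in> Y" "(w, E) \<in> T'" "Y \<times> T' \<subseteq> T"
      using open_prod_elim[OF T(2,4)] by (metis mem_Sigma_iff)
    obtain W I where I: "open W" "open I" "w \<in> W" "E \<in> I" "W \<times> I \<subseteq> T'"
      using open_prod_elim[OF T'(2,4)] by (metis mem_Sigma_iff)
    have "X \<times> Y \<times> W \<times> I \<subseteq> D" using T(5) T'(5) I(5) by blast
    with T T' I that show ?thesis by blast
  qed
  obtain e where e: "0 < e" "ball E e \<subseteq> I" using box open_contains_ball by blast
  have inD: "?p s v F \<in> D" if "s \<in> Y" "v \<in> W" "F \<in> ball E e" for s v F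
    using that box e by auto
  have ratio: "g (?p s v F) / F = g (?p s v E) / E" if sv: "s \<in> Y" "v \<in> W" and F: "F \<in> ball E e" for s v F
  proof -
    \<comment> \<open>The relation \<open>\<psi>\<^sub>E = \<psi> / E\<close> says precisely that
      \<psi> / E has zero derivative in E.\<close>
    have "((\<lambda>F. g (?p s v F) / F) has_real_derivative 0) (at F)" if F: "F \<in> ball E e" for F
    proof -
      have "((\<lambda>F. g (?p s v F)) has_real_derivative DE g (?p s v F)) (at F)"
        using real_analytic_on_line[OF g inD[OF sv F] dir_Basis(4), of F] by simp
      moreover have "DE g (?p s v F) = g (?p s v F) / F"
        by (rule generator_psi_linear[OF gen f refl inD[OF sv F]])
      ultimately have d: "((\<lambda>F. g (?p s v F)) has_real_derivative g (?p s v F) / F) (at F)"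
        by simp
      show ?thesis
        using nz[OF inD[OF sv F]] by (auto intro!: derivative_eq_intros d)
    qed
    then have "(\<lambda>F. g (?p s v F) / F) constant_on ball E e"
      by (intro has_field_derivative_0_imp_constant_on) (auto intro: has_field_derivative_at_within)
    then show ?thesis using F e unfolding constant_on_def by force
  qed
  define F where "F = E + e / 2"
  have F: "F \<in> ball E e" "F \<noteq> E" using e by (auto simp: F_def dist_real_def)
  have F0: "F \<noteq> 0" using nz inD F box by blast
  have pF: "?p y w F \<in> D" using inD F box by blast
  define m where "m = g (?p y w E) / E"
  have gF: "g (?p s v F) = F / E * g (?p s v E)" if "s \<in> Y" "v \<in> W" for s v
    using ratio[OF that F(1)] F0 E by (simp add: field_simps)
  have dy: "Dy g (?p y w F) = F / E * Dy g (?p y w E)"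
  proof -
    have "((\<lambda>s. F / E * g (?p s w E)) has_real_derivative F / E * Dy g (?p y w E)) (at y)"
      using real_analytic_on_line[OF g p dir_Basis(2), of y] by (intro DERIV_cmult) simp
    then have "((\<lambda>s. g (?p s w F)) has_real_derivative F / E * Dy g (?p y w E)) (at y)"
      by (rule has_field_derivative_transform_within_open[OF _ box(2,6)]) (use gF box in auto)
    moreover have "((\<lambda>s. g (?p s w F)) has_real_derivative Dy g (?p y w F)) (at y)"
      using real_analytic_on_line[OF g pF dir_Basis(2), of y] by simp
    ultimately show ?thesis by (metis DERIV_unique)
  qed
  have dw: "Dw g (?p y w F) = F / E * Dw g (?p y w E)"
  proof -
    have "((\<lambda>s. F / E * g (?p y s E)) has_real_derivative F / E * Dw g (?p y w E)) (at w)"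
      using real_analytic_on_line[OF g p dir_Basis(3), of w] by (intro DERIV_cmult) simp
    then have "((\<lambda>s. g (?p y s F)) has_real_derivative F / E * Dw g (?p y w E)) (at w)"
      by (rule has_field_derivative_transform_within_open[OF _ box(3,7)]) (use gF box in auto)
    moreover have "((\<lambda>s. g (?p y s F)) has_real_derivative Dw g (?p y w F)) (at w)"
      using real_analytic_on_line[OF g pF dir_Basis(3), of w] by simp
    ultimately show ?thesis by (metis DERIV_unique)
  qed
  let ?q = "?p y w E"
  have f_eq: "f (?p y w F) = f ?q" "\<And>b. pd b f (?p y w F) = pd b f ?q"
    "\<And>b c. pd b (pd c f) (?p y w F) = pd b (pd c f) ?q"
    by (rule E_indepD, intro E_indep_pd f)+
  \<comment> \<open>The constant term of the residual, divided by E after moving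
    \<open>m + \<phi>\<^sub>w\<close> to the other side. As \<open>g\<close> and its y- and
    w-derivatives scale linearly with E, the value at \<open>F\<close> is the same.\<close>
  define S where "S = (Dy f ?q + f ?q * Dw f ?q) * m
      + (Dy g ?q / E + f ?q * (Dw g ?q / E) + m * m) * f ?q
      + (Dx (Dx f) ?q + Dy (Dy f) ?q + 2 * f ?q * Dw (Dy f) ?q + (f ?q)\<^sup>2 * Dw (Dw f) ?q)
      - (m + Dw f ?q) * f ?q * m"
  have gm: "g ?q = E * m" "g (?p y w F) = F * m" using E gF[OF box(6,7)] by (auto simp: m_def)
  have DEm: "DE g ?q = m" "DE g (?p y w F) = m"
    using generator_psi_linear[OF gen f refl p] generator_psi_linear[OF gen f refl pF] gm E F0
    by simp_all
  have "E * S = m + Dw f ?q"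
    using generator_residual[OF gen f refl p refl refl, of 0 0] E
    unfolding DEm gm S_def by (simp add: algebra_simps power2_eq_square del: dir.simps(1-4))
  moreover have "F * S = m + Dw f ?q"
    using generator_residual[OF gen f refl pF refl refl, of 0 0] E F0
    unfolding DEm gm f_eq dy dw S_def
    by (simp add: algebra_simps power2_eq_square del: dir.simps(1-4))
  ultimately have "S = 0" using F(2) by (metis mult_cancel_right)
  with \<open>E * S = m + Dw f ?q\<close> have "m = - Dw f ?q" by simp
  then show ?thesis using gm(1) by simp
qed

section \<open>Functions of u = kx + y and w, and the equation for Q\<close>

definition shear :: "real \<Rightarrow> point \<Rightarrow> real \<times> real" where
  "shear k = (\<lambda>(x, y, w, E). (k * x + y, w))"

lemma real_analytic_on_shear:
  assumes "real_analytic_on g \<Omega>" "\<And>p. p \<in> D \<Longrightarrow> shear k p \<in> \<Omega>"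
  shows "real_analytic_on (\<lambda>p. g (shear k p)) D"
proof (rule real_analytic_on_compose[OF assms])
  fix b :: "real \<times> real" assume "b \<in> Basis"
  then consider "b = (1, 0)" | "b = (0, 1)" by (auto simp: Basis_real_pair)
  then show "real_analytic_on (\<lambda>p. shear k p \<bullet> b) D"
  proof cases
    case 1
    have "(\<lambda>p. shear k p \<bullet> b) = (\<lambda>p. k * (p \<bullet> dir Jx) + p \<bullet> dir Jy)"
      by (auto simp: shear_def 1)
    then show ?thesis
      by (simp only: real_analytic_on_add real_analytic_on_mult real_analytic_on_const
          real_analytic_on_inner dir_Basis)
  next
    case 2
    have "(\<lambda>p. shear k p \<bullet> b) = (\<lambda>p. p \<bullet> dir Jw)"
      by (auto simp: shear_def 2)
    then show ?thesis by (simp only: real_analytic_on_inner dir_Basis)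
  qed
qed

lemma pd_shear:
  assumes g: "real_analytic_on g \<Omega>" "shear k p \<in> \<Omega>"
  shows "Dx (\<lambda>p. g (shear k p)) p = k * D_u g (shear k p)"
    and "Dy (\<lambda>p. g (shear k p)) p = D_u g (shear k p)"
    and "Dw (\<lambda>p. g (shear k p)) p = D_w g (shear k p)"
proof -
  obtain x y w E where p: "p = (x, y, w, E)" by (cases p)
  have q: "(k * x + y, w) \<in> \<Omega>" using g(2) by (simp add: p shear_def)
  \<comment> \<open>The speed \<open>c\<close> of u is \<open>k\<close> for a move in x and 1 for a
    move in y, so both chain rules come from one computation.\<close>
  have u: "((\<lambda>t. g (k * x + y + c * t, w)) has_real_derivative D_u g (k * x + y, w) * c) (at 0)" for c
  proof (rule DERIV_chain2[where f = "\<lambda>t. g (t, w)"])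
    show "((\<lambda>t. g (t, w)) has_real_derivative D_u g (k * x + y, w)) (at (k * x + y + c * 0))"
      using has_derivative_D_u[OF g(1) q] by simp
  qed (auto intro!: derivative_eq_intros)
  show "Dx (\<lambda>p. g (shear k p)) p = k * D_u g (shear k p)"
    using DERIV_imp_deriv[OF u[of k]] by (simp add: pd_def p shear_def algebra_simps)
  show "Dy (\<lambda>p. g (shear k p)) p = D_u g (shear k p)"
    using DERIV_imp_deriv[OF u[of 1]] by (simp add: pd_def p shear_def algebra_simps)
  show "Dw (\<lambda>p. g (shear k p)) p = D_w g (shear k p)"
    by (simp add: pd_def p shear_def D_w_def deriv_shift_0[of _ w] o_def)
qed

text \<open>By the quotient rule the equation for \<open>Q\<close> becomes
  \<open>h\<^sub>u = 1 / Q\<^sub>w\<close>. Differentiating once more gives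
  \<open>h\<^sub>u\<^sub>u = - Q\<^sub>u\<^sub>w / Q\<^sub>w\<^sup>2\<close> and
  \<open>h\<^sub>u\<^sub>w = - Q\<^sub>w\<^sub>w / Q\<^sub>w\<^sup>2\<close>; in
  \<open>h h\<^sub>u\<^sub>w - h\<^sub>w h\<^sub>u\<close> the terms with
  \<open>Q\<^sub>w\<^sub>w\<close> cancel.\<close>

lemma quotient_derivatives:
  assumes \<Omega>: "open \<Omega>" and Q: "real_analytic_on Q \<Omega>" and nz: "\<forall>q\<in>\<Omega>. D_w Q q \<noteq> 0"
    and eq: "\<forall>q\<in>\<Omega>. D_u Q q * D_w (\<lambda>(u, w). D_u Q (u, w) - u) q
                     - D_w Q q * D_u (\<lambda>(u, w). D_u Q (u, w) - u) q = 0"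
    and q: "q \<in> \<Omega>"
  defines "h \<equiv> \<lambda>q. D_u Q q / D_w Q q"
  shows "D_u (D_u h) q = h q * D_w (D_u h) q - D_w h q * D_u h q"
proof -
  note Qu = real_analytic_on_D_u[OF Q] and Qw = real_analytic_on_D_w[OF Q]
  have mixed: "D_u (D_w Q) p = D_w (D_u Q) p" if "p \<in> \<Omega>" for p
    using D_w_D_u[OF Q that] by simp
  have rel: "D_u Q p * D_w (D_u Q) p - D_w Q p * (D_u (D_u Q) p - 1) = 0" if p: "p \<in> \<Omega>" for p
  proof -
    obtain u w where uw: "p = (u, w)" by (cases p)
    have "D_w (\<lambda>(u, w). D_u Q (u, w) - u) p = D_w (D_u Q) p"
      unfolding D_w_def[of "\<lambda>(u, w). D_u Q (u, w) - u"] uw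
      by (simp, rule DERIV_imp_deriv)
        (auto intro!: derivative_eq_intros has_derivative_D_w[OF Qu p[unfolded uw]])
    moreover have "D_u (\<lambda>(u, w). D_u Q (u, w) - u) p = D_u (D_u Q) p - 1"
      unfolding D_u_def[of "\<lambda>(u, w). D_u Q (u, w) - u"] uw
      by (simp, rule DERIV_imp_deriv)
        (auto intro!: derivative_eq_intros has_derivative_D_u[OF Qu p[unfolded uw]])
    ultimately show ?thesis using bspec[OF eq p] by (simp only:)
  qed
  have hu: "D_u h p = 1 / D_w Q p" if p: "p \<in> \<Omega>" for p
  proof -
    obtain u w where uw: "p = (u, w)" by (cases p)
    have "((\<lambda>t. h (t, w)) has_real_derivative
      (D_u (D_u Q) p * D_w Q p - D_u Q p * D_u (D_w Q) p) / (D_w Q p * D_w Q p)) (at u)"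
      unfolding h_def uw using nz p
      by (intro DERIV_divide has_derivative_D_u[OF Qu] has_derivative_D_u[OF Qw]) (auto simp: uw)
    moreover have "D_u (D_u Q) p * D_w Q p - D_u Q p * D_u (D_w Q) p = D_w Q p"
      using rel[OF p] mixed[OF p] by (simp add: algebra_simps)
    ultimately show ?thesis using nz p by (simp add: D_u_def uw DERIV_imp_deriv)
  qed
  obtain u w where uw: "q = (u, w)" by (cases q)
  note q' = q[unfolded uw]
  have nzq: "D_w Q (u, w) \<noteq> 0" using nz q' by blast
  \<comment> \<open>\<open>hu\<close> is known on the open set \<open>\<Omega>\<close>, hence may be
    differentiated at \<open>q\<close>.\<close>
  have "D_u (D_u h) q = D_u (\<lambda>p. 1 / D_w Q p) q"
    unfolding D_u_eq_pd[of "D_u h"] D_u_eq_pd[of "\<lambda>p. 1 / D_w Q p"] by (rule pd_cong[OF \<Omega> q hu])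
  also have "\<dots> = - D_u (D_w Q) q / (D_w Q q)\<^sup>2"
    unfolding D_u_def[of "\<lambda>p. 1 / D_w Q p"] uw
    by (simp, rule DERIV_imp_deriv)
      (auto intro!: derivative_eq_intros has_derivative_D_u[OF Qw q'] simp: nzq power2_eq_square)
  finally have huu: "D_u (D_u h) q = - D_w (D_u Q) q / (D_w Q q)\<^sup>2" using mixed[OF q] by simp
  have "D_w (D_u h) q = D_w (\<lambda>p. 1 / D_w Q p) q"
    unfolding D_w_eq_pd[of "D_u h"] D_w_eq_pd[of "\<lambda>p. 1 / D_w Q p"] by (rule pd_cong[OF \<Omega> q hu])
  also have "\<dots> = - D_w (D_w Q) q / (D_w Q q)\<^sup>2"
    unfolding D_w_def[of "\<lambda>p. 1 / D_w Q p"] uw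
    by (simp, rule DERIV_imp_deriv)
      (auto intro!: derivative_eq_intros has_derivative_D_w[OF Qw q'] simp: nzq power2_eq_square)
  finally have huw: "D_w (D_u h) q = - D_w (D_w Q) q / (D_w Q q)\<^sup>2" .
  have "((\<lambda>t. h (u, t)) has_real_derivative
      (D_w (D_u Q) q * D_w Q q - D_u Q q * D_w (D_w Q) q) / (D_w Q q * D_w Q q)) (at w)"
    unfolding h_def uw
    by (intro DERIV_divide has_derivative_D_w[OF Qu q'] has_derivative_D_w[OF Qw q'] nzq)
  then have hw: "D_w h q = (D_w (D_u Q) q * D_w Q q - D_u Q q * D_w (D_w Q) q) / (D_w Q q)\<^sup>2"
    by (simp add: D_w_def uw DERIV_imp_deriv power2_eq_square)
  have "D_w Q q \<noteq> 0" using nzq uw by simp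
  then show ?thesis
    unfolding huu huw hw hu[OF q] by (simp add: h_def field_simps power2_eq_square)
qed

section \<open>Existence and uniqueness of the generator\<close>

theorem proposition10:
  fixes k :: real and Q :: "real \<times> real \<Rightarrow> real" and \<Omega> :: "(real \<times> real) set"
    and D :: "point set"
    and A :: "real \<Rightarrow> real \<Rightarrow> real" and G :: "real \<Rightarrow> real \<Rightarrow> real \<Rightarrow> real"
    and V :: vfield
  assumes k: "k \<noteq> 0"
    and Q: "open \<Omega>" "real_analytic_on Q \<Omega>" "\<forall>q\<in>\<Omega>. D_w Q q \<noteq> 0"
    and Q_eq: "\<forall>q\<in>\<Omega>. D_u Q q * D_w (\<lambda>(u, w). D_u Q (u, w) - u) q
                     - D_w Q q * D_u (\<lambda>(u, w). D_u Q (u, w) - u) q = 0"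
    and D: "open D" "\<forall>(x, y, w, E)\<in>D. (k * x + y, w) \<in> \<Omega> \<and> E \<noteq> 0"
    and A: "\<forall>(x, y, w, E)\<in>D. A x y = k"
    and G: "\<forall>(x, y, w, E)\<in>D.
              G x y w = - (k\<^sup>2 + 1) * (D_u Q (k * x + y, w) / D_w Q (k * x + y, w))"
    and V: "V = \<lparr>xi = (\<lambda>(x, y, w, E). k),
                 eta = (\<lambda>(x, y, w, E). 1),
                 phi = (\<lambda>(x, y, w, E).
                   - (k\<^sup>2 + 1) * (D_u Q (k * x + y, w) / D_w Q (k * x + y, w))),
                 psi = (\<lambda>(x, y, w, E).
                   (k\<^sup>2 + 1) * E * D_w (\<lambda>q. D_u Q q / D_w Q q) (k * x + y, w))\<rparr>"
  shows "nonclassical_generator D V \<and>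
    (\<forall>U. nonclassical_generator D U \<and>
         (\<forall>(x, y, w, E)\<in>D. xi U (x, y, w, E) = A x y \<and> phi U (x, y, w, E) = G x y w) \<longrightarrow>
         (\<forall>p\<in>D. xi U p = xi V p \<and> eta U p = eta V p \<and> phi U p = phi V p \<and> psi U p = psi V p))"
proof -
  define c where "c = k\<^sup>2 + 1"
  define h where "h q = D_u Q q / D_w Q q" for q
  \<comment> \<open>Composition with \<open>shear\<close> defines \<phi> on the whole space, so that
    it is independent of E everywhere.\<close>
  define f where "f p = - c * h (shear k p)" for p
  define g where "g p = - snd (snd (snd p)) * Dw f p" for p
  have sh: "shear k p \<in> \<Omega>" if "p \<in> D" for p
    using D(2) that by (fastforce simp: shear_def)
  have nzD: "snd (snd (snd p)) \<noteq> 0" if "p \<in> D" for p using D(2) that by fastforce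
  have h: "real_analytic_on h \<Omega>"
    unfolding h_def[abs_def] using Q
    by (intro real_analytic_on_divide real_analytic_on_D_u real_analytic_on_D_w) auto
  have H: "real_analytic_on (\<lambda>p. F (shear k p)) D" if "real_analytic_on F \<Omega>" for F
    by (rule real_analytic_on_shear[OF that sh])
  have f: "real_analytic_on f D"
    unfolding f_def[abs_def] by (intro real_analytic_on_mult real_analytic_on_const H h)
  have ind: "E_indep f" by (simp add: E_indep_def f_def shear_def)
  have fp: "pd b f p = - c * pd b (\<lambda>p. h (shear k p)) p" if "p \<in> D" "b \<in> Basis" for b p
    unfolding f_def[abs_def] by (rule pd_cmult[OF H[OF h] that])
  have fx: "Dx f p = - c * (k * D_u h (shear k p))" and fy: "Dy f p = - c * D_u h (shear k p)"
    and fw: "Dw f p = - c * D_w h (shear k p)" if "p \<in> D" for p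
    by (simp_all only: fp[OF that dir_Basis(1)] fp[OF that dir_Basis(2)] fp[OF that dir_Basis(3)]
        pd_shear[OF h sh[OF that]])
  have fyb: "pd b (Dy f) p = - c * pd b (\<lambda>p. D_u h (shear k p)) p" if "p \<in> D" "b \<in> Basis" for b p
    by (rule trans[OF pd_cong[OF D(1) that(1)] pd_cmult[OF H[OF real_analytic_on_D_u[OF h]] that]])
      (rule fy)
  have fyy: "Dy (Dy f) p = - c * D_u (D_u h) (shear k p)"
    and fyw: "Dw (Dy f) p = - c * D_w (D_u h) (shear k p)" if "p \<in> D" for p
    by (simp_all only: fyb[OF that dir_Basis(2)] fyb[OF that dir_Basis(3)]
        pd_shear[OF real_analytic_on_D_u[OF h] sh[OF that]])
  have "nonclassical_generator D (vf k f g)"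
    unfolding g_def[abs_def]
  proof (rule generator_sufficient[OF D(1) nzD f ind])
    fix p assume p: "p \<in> D"
    show "Dx f p = k * Dy f p" using fx[OF p] fy[OF p] by (simp del: dir.simps(1-4))
    have huu: "D_u (D_u h) (shear k p) = h (shear k p) * D_w (D_u h) (shear k p)
            - D_w h (shear k p) * D_u h (shear k p)"
      unfolding h_def[abs_def] by (rule quotient_derivatives[OF Q Q_eq sh[OF p]])
    show "(k\<^sup>2 + 1) * Dy (Dy f) p = Dw f p * Dy f p - f p * Dw (Dy f) p"
      unfolding fyy[OF p] fyw[OF p] fw[OF p] fy[OF p] f_def c_def[symmetric] huu
      by (simp add: algebra_simps)
  qed
  moreover have V_sel: "xi (vf k f g) p = xi V p" "eta (vf k f g) p = eta V p"
    "phi (vf k f g) p = phi V p" "psi (vf k f g) p = psi V p" if p: "p \<in> D" for p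
  proof -
    \<comment> \<open>The two minus signs, from \<psi> = -E \<open>\<phi>\<^sub>w\<close> and from
      \<phi> = -c h, cancel.\<close>
    have "g p = snd (snd (snd p)) * (c * D_w h (shear k p))"
      by (simp only: g_def fw[OF p])
    then show "xi (vf k f g) p = xi V p" "eta (vf k f g) p = eta V p"
      "phi (vf k f g) p = phi V p" "psi (vf k f g) p = psi V p"
      by (auto simp: V f_def c_def h_def[abs_def] shear_def algebra_simps split: prod.splits)
  qed
  ultimately have "nonclassical_generator D V" by (rule nonclassical_generator_cong)
  moreover have "\<forall>p\<in>D. xi U p = xi V p \<and> eta U p = eta V p \<and> phi U p = phi V p \<and> psi U p = psi V p"
    if U: "nonclassical_generator D U"
      and UAG: "\<forall>(x, y, w, E)\<in>D. xi U (x, y, w, E) = A x y \<and> phi U (x, y, w, E) = G x y w" for U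
  proof -
    have eta: "eta U p = 1" if "p \<in> D" for p
      using U that by (simp add: nonclassical_generator_def)
    have "xi U p = k \<and> phi U p = f p" if p: "p \<in> D" for p
    proof -
      obtain x y w E where xywE: "p = (x, y, w, E)" by (cases p)
      show ?thesis
        using bspec[OF UAG p] bspec[OF A p] bspec[OF G p]
        by (simp add: xywE f_def c_def h_def shear_def)
    qed
    then have xi: "xi U p = k" and phi: "phi U p = f p" if "p \<in> D" for p
      using that by blast+
    \<comment> \<open>On \<open>D\<close> the field \<open>U\<close> has the constant \<xi> = k and
      the prescribed \<phi>, so only its \<psi> remains to be identified.\<close>
    have gen: "nonclassical_generator D (vf k f (psi U))"
      by (rule nonclassical_generator_cong[OF U]) (simp_all add: xi phi eta)
    have "psi U p = g p" if p: "p \<in> D" for p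
      using generator_psi[OF gen ind] p by (cases p) (simp add: g_def)
    with xi phi eta V_sel show ?thesis by simp
  qed
  ultimately show ?thesis by blast
qed

end
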